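(* Let $n\geqslant 2$ be an integer and let $c\in[0,1]$. Then $$f_n(c)=\max\{|a_{12}a_{23}\cdots a_{n-1,n}|\},$$ where the maximum (which is attained) is taken over all Hermitian complex $n\times n$ matrices $A=(a_{ij}\,|\,i,j=1,\dots,n)$ such that $a_{ii}=1$ for $i=1,\dots,n$ and $0\leqslant A\leqslant (1+(n-1)c)I$.
   Context: For closed subspaces $H_1,\dots,H_n$ ($n\geqslant 2$) of a complex Hilbert space $H$, put $H_0:=H_1\cap\dots\cap H_n$ and let $P_k$ be the orthogonal projection of $H$ onto $H_k$, $k=0,1,\dots,n$. The Friedrichs number is $$c_F(H_1,\dots,H_n):=\sup\left\{\frac{2}{n-1}\frac{\sum_{i<j}\mathrm{Re}\langle x_i,x_j\rangle}{\|x_1\|^2+\dots+\|x_n\|^2}\,:\, x_i\in H_i\ominus H_0,\ i=1,\dots,n,\ (x_1,\dots,x_n)\neq(0,\dots,0)\right\},$$ where $H_i\ominus H_0$ is the orthogonal complement of $H_0$ in $H_i$ (if all $H_i=H_0$, the supremum is over the empty set and is taken to be $0$). For $c\in[0,1]$, $$f_n(c):=\sup\{\|P_n\cdots P_2P_1-P_0\|\,:\, c_F(H_1,\dots,H_n)\leqslant c\},$$ the supremum being over all complex Hilbert spaces $H$ and all systems of closed subspaces $H_1,\dots,H_n$ of $H$ with $c_F(H_1,\dots,H_n)\leqslant c$. For Hermitian matrices, $A\leqslant B$ means that $B-A$ is positive semidefinite; $I$ is the identity matrix. *)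

theory Defs
  imports
    "HOL-Analysis.Abstract_Metric_Spaces"
    "Jordan_Normal_Form.VS_Connect"
    "Jordan_Normal_Form.Schur_Decomposition"
begin

section \<open>Complex Hilbert spaces\<close>

text \<open>
  The supremum defining \<open>f\<^sub>n(c)\<close> ranges over all Hilbert spaces, so a Hilbert space has to be a value
  and not a type class instance. It is a HOL-Algebra module record over the field of complex numbers,
  extended by an inner product. The fields \<open>mult\<close> and \<open>one\<close>, which module records inherit from
  ring records, play no role.
\<close>

record 'v ip_space = "(complex, 'v) module" +
  ip :: "'v \<Rightarrow> 'v \<Rightarrow> complex"

definition hnorm :: "'v ip_space \<Rightarrow> 'v \<Rightarrow> real" where
  "hnorm H x = sqrt (Re (ip H x x))"

text \<open>Set to 0 off the carrier because the locale \<open>Metric_space\<close> wants a distance that is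
  symmetric and nonnegative on the whole type.\<close>

definition hdist :: "'v ip_space \<Rightarrow> 'v \<Rightarrow> 'v \<Rightarrow> real" where
  "hdist H x y =
     (if x \<in> carrier H \<and> y \<in> carrier H then hnorm H (x \<ominus>\<^bsub>H\<^esub> y) else 0)"

text \<open>The inner product is linear in its first argument. In the positivity axiom, \<open>0 \<le> z\<close> for a
  complex number \<open>z\<close> means that \<open>z\<close> is real and nonnegative.\<close>

locale complex_hilbert_space = vectorspace class_ring H
  for H :: "'v ip_space" (structure) +
  assumes ip_add_left: "\<lbrakk>x \<in> carrier H; y \<in> carrier H; z \<in> carrier H\<rbrakk>
      \<Longrightarrow> ip H (x \<oplus> y) z = ip H x z + ip H y z"
    and ip_smult_left: "\<lbrakk>x \<in> carrier H; y \<in> carrier H\<rbrakk>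
      \<Longrightarrow> ip H (a \<odot>\<^bsub>H\<^esub> x) y = a * ip H x y"
    and ip_commute: "\<lbrakk>x \<in> carrier H; y \<in> carrier H\<rbrakk> \<Longrightarrow> ip H y x = cnj (ip H x y)"
    and ip_nonneg: "x \<in> carrier H \<Longrightarrow> 0 \<le> ip H x x"
    and ip_definite: "\<lbrakk>x \<in> carrier H; ip H x x = 0\<rbrakk> \<Longrightarrow> x = \<zero>"
    and complete: "Metric_space.mcomplete (carrier H) (hdist H)"

definition closed_subspace :: "'v ip_space \<Rightarrow> 'v set \<Rightarrow> bool" where
  "closed_subspace H S \<longleftrightarrow>
     VectorSpace.subspace class_ring S H \<and>
     closedin (Metric_space.mtopology (carrier H) (hdist H)) S"

definition orth_proj :: "'v ip_space \<Rightarrow> 'v set \<Rightarrow> 'v \<Rightarrow> 'v" where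
  "orth_proj H S x = (THE y. y \<in> S \<and> (\<forall>z\<in>S. ip H (x \<ominus>\<^bsub>H\<^esub> y) z = 0))"

definition op_norm :: "'v ip_space \<Rightarrow> ('v \<Rightarrow> 'v) \<Rightarrow> real" where
  "op_norm H T = Sup {hnorm H (T x) | x. x \<in> carrier H \<and> hnorm H x \<le> 1}"

section \<open>Systems of subspaces\<close>

text \<open>A system \<open>H\<^sub>1, \<dots>, H\<^sub>n\<close> is a function \<open>S\<close> on the naturals, of which only the values
  at \<open>1, \<dots>, n\<close> matter.\<close>

definition common_subspace :: "nat \<Rightarrow> (nat \<Rightarrow> 'v set) \<Rightarrow> 'v set" where
  "common_subspace n S = (\<Inter>i\<in>{1..n}. S i)"

definition orth_diff :: "'v ip_space \<Rightarrow> 'v set \<Rightarrow> 'v set \<Rightarrow> 'v set" where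
  "orth_diff H A B = {x \<in> A. \<forall>z\<in>B. ip H x z = 0}"

definition friedrichs_quotients :: "'v ip_space \<Rightarrow> nat \<Rightarrow> (nat \<Rightarrow> 'v set) \<Rightarrow> real set" where
  "friedrichs_quotients H n S =
     {2 / (real n - 1) *
        ((\<Sum>j\<in>{1..n}. \<Sum>i\<in>{1..<j}. Re (ip H (x i) (x j))) / (\<Sum>i\<in>{1..n}. (hnorm H (x i))\<^sup>2)) | x.
        (\<forall>i\<in>{1..n}. x i \<in> orth_diff H (S i) (common_subspace n S)) \<and>
        (\<exists>i\<in>{1..n}. x i \<noteq> \<zero>\<^bsub>H\<^esub>)}"

definition friedrichs_number :: "'v ip_space \<Rightarrow> nat \<Rightarrow> (nat \<Rightarrow> 'v set) \<Rightarrow> real" where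
  "friedrichs_number H n S =
     (if friedrichs_quotients H n S = {} then 0 else Sup (friedrichs_quotients H n S))"

primrec proj_product :: "'v ip_space \<Rightarrow> (nat \<Rightarrow> 'v set) \<Rightarrow> nat \<Rightarrow> 'v \<Rightarrow> 'v" where
  "proj_product H S 0 = (\<lambda>x. x)"
| "proj_product H S (Suc k) = orth_proj H (S (Suc k)) \<circ> proj_product H S k"

text \<open>
  No HOL term quantifies over the Hilbert spaces of all types, so \<open>f\<^sub>n(c)\<close> takes the type \<open>'v\<close>
  that the points are drawn from as an argument; the carrier is an arbitrary subset of \<open>'v\<close>.
  For \<open>'v\<close> of the form \<open>'a \<Rightarrow> complex\<close> with \<open>'a\<close> arbitrary, every complex Hilbert space is covered up
  to isometric isomorphism (take \<open>'a\<close> to index an orthonormal basis), and whatever \<open>'a\<close> is, \<open>'v\<close> has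
  room for all finite-dimensional spaces.
\<close>

definition f_sup :: "'v itself \<Rightarrow> nat \<Rightarrow> real \<Rightarrow> real" where
  "f_sup (_ :: 'v itself) n c =
     Sup {op_norm H (\<lambda>x. proj_product H S n x \<ominus>\<^bsub>H\<^esub> orth_proj H (common_subspace n S) x) |
            (H :: 'v ip_space) S.
            complex_hilbert_space H \<and> (\<forall>i\<in>{1..n}. closed_subspace H (S i)) \<and>
            friedrichs_number H n S \<le> c}"

section \<open>Hermitian matrices\<close>

definition hermitian_mat :: "nat \<Rightarrow> complex mat \<Rightarrow> bool" where
  "hermitian_mat n A \<longleftrightarrow> A \<in> carrier_mat n n \<and> mat_adjoint A = A"

definition psd_mat :: "nat \<Rightarrow> complex mat \<Rightarrow> bool" where
  "psd_mat n A \<longleftrightarrow>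
     hermitian_mat n A \<and> (\<forall>v\<in>carrier_vec n. 0 \<le> (A *\<^sub>v v) \<bullet>c v)"

definition loewner_le :: "nat \<Rightarrow> complex mat \<Rightarrow> complex mat \<Rightarrow> bool" where
  "loewner_le n A B \<longleftrightarrow> psd_mat n (B - A)"

text \<open>Matrix indices start at 0 here, so \<open>a\<^sub>i\<^sub>j\<close> is \<open>A $$ (i - 1, j - 1)\<close>.\<close>

definition admissible_mats :: "nat \<Rightarrow> real \<Rightarrow> complex mat set" where
  "admissible_mats n c =
     {A. hermitian_mat n A \<and> (\<forall>i<n. A $$ (i, i) = 1) \<and>
         loewner_le n (0\<^sub>m n n) A \<and>
         loewner_le n A (complex_of_real (1 + (real n - 1) * c) \<cdot>\<^sub>m 1\<^sub>m n)}"

definition superdiag_prod :: "nat \<Rightarrow> complex mat \<Rightarrow> complex" where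
  "superdiag_prod n A = (\<Prod>i<n - 1. A $$ (i, Suc i))"

end

theory Submission
  imports Defs
begin

text \<open>
  Both inequalities rest on reading the Friedrichs number as a bound on Gram matrices. Completing the
  double sum, $2\sum_{i<j}\mathrm{Re}\langle x_i,x_j\rangle = \|\sum_i x_i\|^2 - \sum_i\|x_i\|^2$, so
  $c_F \le c$ says exactly that $\|\sum_i x_i\|^2 \le (1+(n-1)c)\sum_i\|x_i\|^2$ whenever
  $x_i \in H_i \ominus H_0$ (\<open>friedrichs_number_le_iff\<close>). For unit vectors $u_i \in H_i\ominus H_0$
  and $x_i = t_i u_i$ this is the condition that the Gram matrix of the $u_i$ is at most
  $(1+(n-1)c)I$; so such Gram matrices are admissible (\<open>admissible_gram\<close>).

  Upper bound (\<open>proj_product_bound\<close>). Follow a vector $x$ of norm at most 1 along the partial products: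
  $y_k = P_k\cdots P_1x - P_0x$ lies in $H_k\ominus H_0$, and $y_{k+1}$ is the projection of $y_k$, so
  $\langle y_k,y_{k+1}\rangle=\|y_{k+1}\|^2$. After normalising, neighbours have inner product
  $\|y_{k+1}\|/\|y_k\|$, and the superdiagonal product of the Gram matrix telescopes to
  $\|y_n\|/\|y_1\|\ge\|y_n\|$.

  Lower bound (\<open>scaled_admissible_realized\<close>). If $A$ is admissible and $0<t<1$, then
  $A_t=tA+(1-t)I$ is admissible and positive definite, hence defines an inner product on
  $\mathbb{C}^n$ in which the standard basis consists of unit vectors with Gram matrix $A_t$. The
  lines they span meet only in 0, and $P_n\cdots P_1$ sends the first basis vector to a multiple of the
  last one, the factor having modulus $t^{n-1}|a_{12}\cdots a_{n-1,n}|$. Letting $t\to1$ gives the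
  bound. The perturbation is essential: if $A$ has rank one, unit vectors with Gram matrix $A$ span one
  and the same line, so that $P_n\cdots P_1-P_0$ vanishes although the superdiagonal product has
  modulus 1.

  The maximum exists because the admissible matrices, whose entries have modulus at most 1, form a
  compact set (\<open>admissible_attains_max\<close>).
\<close>

section \<open>Complex inner product spaces\<close>

text \<open>The axioms of \<open>complex_hilbert_space\<close> without completeness: the metric and its basic properties
  are needed to state and prove that a concrete space is complete.\<close>

locale complex_inner_product_space = vectorspace class_ring H
  for H :: "'v ip_space" (structure) +
  assumes ip_plus_left: "\<lbrakk>x \<in> carrier H; y \<in> carrier H; z \<in> carrier H\<rbrakk>
      \<Longrightarrow> ip H (x \<oplus> y) z = ip H x z + ip H y z"
    and ip_scale_left: "\<lbrakk>x \<in> carrier H; y \<in> carrier H\<rbrakk>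
      \<Longrightarrow> ip H (a \<odot>\<^bsub>H\<^esub> x) y = a * ip H x y"
    and ip_sym: "\<lbrakk>x \<in> carrier H; y \<in> carrier H\<rbrakk> \<Longrightarrow> ip H y x = cnj (ip H x y)"
    and ip_ge_0: "x \<in> carrier H \<Longrightarrow> 0 \<le> ip H x x"
    and ip_eq_0D: "\<lbrakk>x \<in> carrier H; ip H x x = 0\<rbrakk> \<Longrightarrow> x = \<zero>"

sublocale complex_hilbert_space \<subseteq> complex_inner_product_space H
  by unfold_locales (rule ip_add_left ip_smult_left ip_commute ip_nonneg ip_definite; assumption)+

context complex_inner_product_space
begin

lemma scale_closed [simp]: "x \<in> carrier H \<Longrightarrow> a \<odot>\<^bsub>H\<^esub> x \<in> carrier H"
  using smult_closed[of a x] by simp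

lemma ip_plus_right:
  assumes "x \<in> carrier H" "y \<in> carrier H" "z \<in> carrier H"
  shows "ip H z (x \<oplus> y) = ip H z x + ip H z y"
  using assms by (metis (no_types, opaque_lifting) ip_plus_left ip_sym complex_cnj_add M.add.m_closed)

lemma ip_scale_right:
  assumes "x \<in> carrier H" "y \<in> carrier H"
  shows "ip H x (a \<odot>\<^bsub>H\<^esub> y) = cnj a * ip H x y"
  using assms by (metis (no_types, opaque_lifting) ip_scale_left ip_sym complex_cnj_mult scale_closed)

lemma ip_zero_left [simp]: "z \<in> carrier H \<Longrightarrow> ip H \<zero> z = 0"
  using ip_plus_left[of "\<zero>" "\<zero>" z] by simp

lemma ip_zero_right [simp]: "z \<in> carrier H \<Longrightarrow> ip H z \<zero> = 0"
  using ip_sym[of "\<zero>" z] by simp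

lemma ip_minus_left:
  assumes "x \<in> carrier H" "y \<in> carrier H" "z \<in> carrier H"
  shows "ip H (x \<ominus> y) z = ip H x z - ip H y z"
proof -
  have "ip H (\<ominus> y) z = - ip H y z"
    using ip_plus_left[of y "\<ominus> y" z] assms by (simp add: M.r_neg add_eq_0_iff)
  then show ?thesis
    using assms by (simp add: a_minus_def ip_plus_left)
qed

lemma ip_minus_right:
  assumes "x \<in> carrier H" "y \<in> carrier H" "z \<in> carrier H"
  shows "ip H z (x \<ominus> y) = ip H z x - ip H z y"
  using assms by (metis (no_types, opaque_lifting) ip_minus_left ip_sym complex_cnj_diff M.minus_closed)

lemmas ip_expand = ip_plus_left ip_plus_right ip_minus_left ip_minus_right
  ip_scale_left ip_scale_right

lemma ip_self: "x \<in> carrier H \<Longrightarrow> ip H x x = complex_of_real ((hnorm H x)\<^sup>2)"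
  using ip_ge_0[of x] by (simp add: hnorm_def less_eq_complex_def complex_eq_iff)

lemma hnorm_sq: "x \<in> carrier H \<Longrightarrow> (hnorm H x)\<^sup>2 = Re (ip H x x)"
  by (simp add: ip_self)

lemma hnorm_nonneg [simp]: "x \<in> carrier H \<Longrightarrow> 0 \<le> hnorm H x"
  using ip_ge_0[of x] by (simp add: hnorm_def less_eq_complex_def)

lemma hnorm_eq_0 [simp]: "x \<in> carrier H \<Longrightarrow> hnorm H x = 0 \<longleftrightarrow> x = \<zero>"
  using ip_self[of x] ip_eq_0D[of x] by (auto simp: hnorm_def)

lemma hnorm_zero [simp]: "hnorm H \<zero> = 0"
  by (simp add: hnorm_def)

lemma hnorm_smult:
  assumes x: "x \<in> carrier H"
  shows "hnorm H (a \<odot>\<^bsub>H\<^esub> x) = cmod a * hnorm H x"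
proof (rule power2_eq_imp_eq)
  have "ip H (a \<odot>\<^bsub>H\<^esub> x) (a \<odot>\<^bsub>H\<^esub> x) = (a * cnj a) * ip H x x"
    using x by (simp add: ip_scale_left ip_scale_right)
  also have "\<dots> = complex_of_real ((cmod a)\<^sup>2) * ip H x x"
    by (metis complex_norm_square of_real_power)
  finally show "(hnorm H (a \<odot>\<^bsub>H\<^esub> x))\<^sup>2 = (cmod a * hnorm H x)\<^sup>2"
    using x by (simp add: hnorm_sq power_mult_distrib)
qed (use x in auto)

text \<open>Vector identities are verified by pairing both sides with an arbitrary vector, which turns them
  into identities between complex numbers.\<close>

lemma eq_if_ip_eq:
  assumes "x \<in> carrier H" "y \<in> carrier H" "\<And>z. z \<in> carrier H \<Longrightarrow> ip H x z = ip H y z"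
  shows "x = y"
proof -
  have "ip H (x \<ominus> y) (x \<ominus> y) = 0"
    using assms by (simp add: ip_minus_left)
  then show ?thesis
    using assms ip_eq_0D[of "x \<ominus> y"] by simp
qed

text \<open>Pythagoras for the decomposition of \<open>x\<close> along \<open>y\<close>. That the left-hand side is nonnegative is
  the Cauchy-Schwarz inequality; that it cannot fall below a minimal distance makes minimisers
  orthogonal.\<close>

lemma hnorm_sq_minus_component:
  assumes x: "x \<in> carrier H" and y: "y \<in> carrier H" and "y \<noteq> \<zero>"
  shows "(hnorm H (x \<ominus> (ip H x y / complex_of_real ((hnorm H y)\<^sup>2)) \<odot>\<^bsub>H\<^esub> y))\<^sup>2
    = (hnorm H x)\<^sup>2 - (cmod (ip H x y))\<^sup>2 / (hnorm H y)\<^sup>2"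
proof -
  define N where "N = (hnorm H y)\<^sup>2"
  define p where "p = ip H x y"
  have N: "N > 0" using assms by (simp add: N_def)
  define t where "t = p / complex_of_real N"
  define w where "w = x \<ominus> t \<odot>\<^bsub>H\<^esub> y"
  have "ip H w w = ip H x x - cnj t * p - t * cnj p + t * cnj t * complex_of_real N"
    using x y by (simp add: w_def ip_expand ip_sym[OF x y] p_def ip_self[OF y] N_def algebra_simps)
  also have "\<dots> = complex_of_real ((hnorm H x)\<^sup>2 - (cmod p)\<^sup>2 / N)"
    using N x by (simp add: t_def ip_self field_simps complex_norm_square[symmetric] power2_eq_square)
  finally have "Re (ip H w w) = (hnorm H x)\<^sup>2 - (cmod p)\<^sup>2 / N"
    by simp
  moreover have "(hnorm H w)\<^sup>2 = Re (ip H w w)"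
    using x y by (simp add: w_def hnorm_sq)
  ultimately show ?thesis
    by (simp add: w_def t_def p_def N_def)
qed

lemma Cauchy_Schwarz:
  assumes x: "x \<in> carrier H" and y: "y \<in> carrier H"
  shows "cmod (ip H x y) \<le> hnorm H x * hnorm H y"
proof (cases "y = \<zero>")
  case False
  then have "0 < (hnorm H y)\<^sup>2"
    using y by simp
  moreover have "0 \<le> (hnorm H x)\<^sup>2 - (cmod (ip H x y))\<^sup>2 / (hnorm H y)\<^sup>2"
    using hnorm_sq_minus_component[OF x y False] by (metis zero_le_power2)
  ultimately have "(cmod (ip H x y))\<^sup>2 \<le> (hnorm H x * hnorm H y)\<^sup>2"
    by (simp add: power_mult_distrib pos_divide_le_eq)
  then show ?thesis
    using x y by (simp add: power2_le_iff_abs_le)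
qed (use x in simp)

lemma hnorm_triangle:
  assumes x: "x \<in> carrier H" and y: "y \<in> carrier H"
  shows "hnorm H (x \<oplus> y) \<le> hnorm H x + hnorm H y"
proof (rule power2_le_imp_le)
  have "(hnorm H (x \<oplus> y))\<^sup>2 = (hnorm H x)\<^sup>2 + (hnorm H y)\<^sup>2 + 2 * Re (ip H x y)"
    using x y by (simp add: hnorm_sq ip_expand ip_sym[OF x y])
  also have "Re (ip H x y) \<le> hnorm H x * hnorm H y"
    using Cauchy_Schwarz[OF x y] complex_Re_le_cmod order_trans by blast
  finally show "(hnorm H (x \<oplus> y))\<^sup>2 \<le> (hnorm H x + hnorm H y)\<^sup>2"
    by (simp add: power2_sum)
qed (use x y in simp)

lemma hdist_eq: "\<lbrakk>x \<in> carrier H; y \<in> carrier H\<rbrakk> \<Longrightarrow> hdist H x y = hnorm H (x \<ominus> y)"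
  by (simp add: hdist_def)

lemma Metric_space_hdist: "Metric_space (carrier H) (hdist H)"
proof
  fix x y z
  show "0 \<le> hdist H x y"
    by (simp add: hdist_def)
  show "hdist H x y = hdist H y x"
    by (auto simp: hdist_def hnorm_def ip_expand algebra_simps)
  show "hdist H x y = 0 \<longleftrightarrow> x = y" if "x \<in> carrier H" "y \<in> carrier H"
    using that by (simp add: hdist_def)
  show "hdist H x z \<le> hdist H x y + hdist H y z"
    if "x \<in> carrier H" "y \<in> carrier H" "z \<in> carrier H"
  proof -
    have "x \<ominus> z = (x \<ominus> y) \<oplus> (y \<ominus> z)"
      by (rule eq_if_ip_eq) (use that in \<open>auto simp: ip_expand\<close>)
    then show ?thesis
      using that hnorm_triangle[of "x \<ominus> y" "y \<ominus> z"] by (simp add: hdist_def)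
  qed
qed

sublocale metric: Metric_space "carrier H" "hdist H"
  by (rule Metric_space_hdist)

end

section \<open>Closed subspaces and orthogonal projections\<close>

context complex_inner_product_space
begin

lemma closed_subspaceD:
  assumes "closed_subspace H S"
  shows closed_subspace_subset: "S \<subseteq> carrier H"
    and closed_subspace_zero: "\<zero> \<in> S"
    and closed_subspace_add: "\<And>x y. \<lbrakk>x \<in> S; y \<in> S\<rbrakk> \<Longrightarrow> x \<oplus> y \<in> S"
    and closed_subspace_smult: "\<And>a x. x \<in> S \<Longrightarrow> a \<odot>\<^bsub>H\<^esub> x \<in> S"
  using assms unfolding closed_subspace_def VectorSpace.subspace_def LinearCombinations.submodule_def
  by auto

lemma closed_subspace_minus:
  assumes S: "closed_subspace H S" and "x \<in> S" "y \<in> S"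
  shows "x \<ominus> y \<in> S"
proof -
  have "x \<in> carrier H" "y \<in> carrier H"
    using assms closed_subspace_subset by auto
  then have "x \<ominus> y = x \<oplus> (-1) \<odot>\<^bsub>H\<^esub> y"
    by (intro eq_if_ip_eq) (auto simp: ip_expand)
  then show ?thesis
    using assms by (simp add: closed_subspace_add closed_subspace_smult)
qed

lemma subspaceI:
  assumes "S \<subseteq> carrier H" "\<zero> \<in> S" "\<And>x y. \<lbrakk>x \<in> S; y \<in> S\<rbrakk> \<Longrightarrow> x \<oplus> y \<in> S"
    "\<And>a x. x \<in> S \<Longrightarrow> a \<odot>\<^bsub>H\<^esub> x \<in> S"
  shows "VectorSpace.subspace class_ring S H"
  unfolding VectorSpace.subspace_def LinearCombinations.submodule_def
  using assms vectorspace_axioms module_axioms by auto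

text \<open>The parallelogram law for \<open>x - y\<close> and \<open>x - z\<close>: two points that are both almost as close
  to \<open>x\<close> as possible are close to each other, since their midpoint cannot be much closer to \<open>x\<close>.\<close>

lemma hnorm_parallelogram:
  assumes "x \<in> carrier H" "y \<in> carrier H" "z \<in> carrier H"
  shows "(hnorm H (y \<ominus> z))\<^sup>2 = 2 * (hnorm H (x \<ominus> y))\<^sup>2 + 2 * (hnorm H (x \<ominus> z))\<^sup>2
    - 4 * (hnorm H (x \<ominus> (1/2) \<odot>\<^bsub>H\<^esub> (y \<oplus> z)))\<^sup>2"
  using assms by (simp add: hnorm_sq ip_expand field_simps)

lemma orth_proj_eqI:
  assumes S: "closed_subspace H S" and x: "x \<in> carrier H" and y: "y \<in> S"
    and orth: "\<And>z. z \<in> S \<Longrightarrow> ip H (x \<ominus> y) z = 0"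
  shows "orth_proj H S x = y"
  unfolding orth_proj_def
proof (rule the_equality)
  fix y' assume y': "y' \<in> S \<and> (\<forall>z\<in>S. ip H (x \<ominus> y') z = 0)"
  have C: "y \<in> carrier H" "y' \<in> carrier H"
    using y y' closed_subspace_subset[OF S] by auto
  have "y' \<ominus> y \<in> S"
    using y y' closed_subspace_minus[OF S] by auto
  then have "ip H (x \<ominus> y) (y' \<ominus> y) = 0" "ip H (x \<ominus> y') (y' \<ominus> y) = 0"
    using orth y' by auto
  then have "ip H (y' \<ominus> y) (y' \<ominus> y) = 0"
    using x C by (simp add: ip_minus_left)
  then show "y' = y"
    using C ip_eq_0D[of "y' \<ominus> y"] by simp
qed (use y orth in auto)

lemma closed_subspace_common:
  assumes "n \<ge> 1" and S: "\<And>i. i \<in> {1..n} \<Longrightarrow> closed_subspace H (S i)"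
  shows "closed_subspace H (common_subspace n S)"
proof -
  have "VectorSpace.subspace class_ring (common_subspace n S) H"
  proof (rule subspaceI)
    show "common_subspace n S \<subseteq> carrier H"
      using closed_subspace_subset[OF S[of 1]] \<open>n \<ge> 1\<close> by (auto simp: common_subspace_def)
  qed (use closed_subspaceD[OF S] in \<open>auto simp: common_subspace_def\<close>)
  moreover have "closedin metric.mtopology (common_subspace n S)"
    unfolding common_subspace_def
    by (rule closedin_Inter) (use assms in \<open>auto simp: closed_subspace_def\<close>)
  ultimately show ?thesis
    by (simp add: closed_subspace_def)
qed

text \<open>A limit \<open>l\<close> of points on the line differs from its own component along \<open>u\<close> by a vector
  \<open>w\<close> orthogonal to the line, and the norm of \<open>w\<close> is at most the distance from \<open>l\<close> to any point of
  the line.\<close>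

lemma closed_subspace_line:
  assumes u: "u \<in> carrier H"
  shows "closed_subspace H (range (\<lambda>a. a \<odot>\<^bsub>H\<^esub> u))"
proof (cases "u = \<zero>")
  case True
  then have "range (\<lambda>a. a \<odot>\<^bsub>H\<^esub> u) = {\<zero>}" by auto
  then show ?thesis
    unfolding closed_subspace_def
    by (auto intro!: subspaceI closedin_Hausdorff_sing_eq[THEN iffD2] metric.Hausdorff_space_mtopology)
next
  case False
  let ?S = "range (\<lambda>a. a \<odot>\<^bsub>H\<^esub> u)"
  have "VectorSpace.subspace class_ring ?S H"
  proof (rule subspaceI)
    have "\<zero> = 0 \<odot>\<^bsub>H\<^esub> u"
      by (rule eq_if_ip_eq) (use u in \<open>auto simp: ip_expand\<close>)
    then show "\<zero> \<in> ?S" by blast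
    fix x y assume "x \<in> ?S" "y \<in> ?S"
    then obtain a b where "x = a \<odot>\<^bsub>H\<^esub> u" "y = b \<odot>\<^bsub>H\<^esub> u" by auto
    then have "x \<oplus> y = (a + b) \<odot>\<^bsub>H\<^esub> u"
      by (intro eq_if_ip_eq) (use u in \<open>auto simp: ip_expand algebra_simps\<close>)
    then show "x \<oplus> y \<in> ?S" by blast
  next
    fix a x assume "x \<in> ?S"
    then obtain b where "x = b \<odot>\<^bsub>H\<^esub> u" by auto
    then have "a \<odot>\<^bsub>H\<^esub> x = (a * b) \<odot>\<^bsub>H\<^esub> u"
      by (intro eq_if_ip_eq) (use u in \<open>auto simp: ip_expand algebra_simps\<close>)
    then show "a \<odot>\<^bsub>H\<^esub> x \<in> ?S" by blast
  qed (use u in auto)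
  moreover have "closedin metric.mtopology ?S"
    unfolding metric.metric_closedin_iff_sequentially_closed
  proof (intro conjI allI impI)
    show "?S \<subseteq> carrier H" using u by auto
    fix \<sigma> l assume "range \<sigma> \<subseteq> ?S \<and> limitin metric.mtopology \<sigma> l sequentially"
    then have \<sigma>: "range \<sigma> \<subseteq> ?S" and lim: "limitin metric.mtopology \<sigma> l sequentially" by auto
    have l: "l \<in> carrier H"
      using lim by (simp add: metric.limitin_mspace)
    define t where "t = ip H l u / complex_of_real ((hnorm H u)\<^sup>2)"
    define w where "w = l \<ominus> t \<odot>\<^bsub>H\<^esub> u"
    have w: "w \<in> carrier H" using l u by (simp add: w_def)
    have uw: "ip H w u = 0"
      using l u False by (simp add: w_def ip_expand t_def ip_self[OF u])
    have "hnorm H w \<le> hdist H (\<sigma> k) l" for k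
    proof (cases "w = \<zero>")
      case True then show ?thesis by simp
    next
      case wnz: False
      obtain b where b: "\<sigma> k = b \<odot>\<^bsub>H\<^esub> u" using \<sigma> by auto
      have "ip H w w = ip H w (l \<ominus> \<sigma> k)"
        using l u w uw by (subst (2) w_def) (simp add: ip_expand b)
      then have "(hnorm H w)\<^sup>2 \<le> hnorm H w * hdist H l (\<sigma> k)"
        using Cauchy_Schwarz[of w "l \<ominus> \<sigma> k"] complex_Re_le_cmod[of "ip H w w"] l u w b
        by (simp add: hnorm_sq hdist_eq)
      then show ?thesis
        using wnz w metric.commute[of l "\<sigma> k"]
        by (simp add: power2_eq_square less_le)
    qed
    moreover have "(\<lambda>k. hdist H (\<sigma> k) l) \<longlonglongrightarrow> 0"
      using lim by (simp add: metric.limitin_metric_dist_null)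
    ultimately have "hnorm H w \<le> 0"
      using LIMSEQ_le_const by fastforce
    then have "w = \<zero>"
      using w hnorm_eq_0[of w] hnorm_nonneg[of w] by linarith
    then have "l = t \<odot>\<^bsub>H\<^esub> u"
      using l u by (simp add: w_def)
    then show "l \<in> ?S" by blast
  qed
  ultimately show ?thesis
    by (simp add: closed_subspace_def)
qed

lemma orth_proj_line:
  assumes u: "u \<in> carrier H" "hnorm H u = 1" and x: "x \<in> carrier H"
  shows "orth_proj H (range (\<lambda>a. a \<odot>\<^bsub>H\<^esub> u)) x = ip H x u \<odot>\<^bsub>H\<^esub> u"
  using u by (intro orth_proj_eqI closed_subspace_line x)
    (auto simp: x ip_expand ip_self)

end

context complex_hilbert_space
begin

text \<open>The projection theorem: a sequence in \<open>S\<close> that minimises the distance to \<open>x\<close> is Cauchy by the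
  parallelogram law, and its limit satisfies the orthogonality relation because moving it in the
  direction of \<open>z\<close> does not decrease the distance.\<close>

theorem orth_proj_exists:
  assumes S: "closed_subspace H S" and x: "x \<in> carrier H"
  shows "\<exists>y\<in>S. \<forall>z\<in>S. ip H (x \<ominus> y) z = 0"
proof -
  note SC = closed_subspace_subset[OF S]
  define f where "f y = (hnorm H (x \<ominus> y))\<^sup>2" for y
  define d where "d = Inf (f ` S)"
  have ne: "f ` S \<noteq> {}"
    using closed_subspace_zero[OF S] by auto
  have bdd: "bdd_below (f ` S)"
    by (rule bdd_belowI[of _ 0]) (auto simp: f_def)
  have lower: "d \<le> f y" if "y \<in> S" for y
    using that bdd by (simp add: d_def cInf_lower)
  have d0: "0 \<le> d"
    unfolding d_def by (rule cInf_greatest[OF ne]) (auto simp: f_def)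
  have "\<exists>y\<in>S. f y < d + 1 / real (Suc k)" for k
  proof -
    have "Inf (f ` S) < d + 1 / real (Suc k)" by (simp add: d_def)
    then show ?thesis using cInf_lessD[OF ne] by auto
  qed
  then obtain \<sigma> where \<sigma>S: "\<And>k. \<sigma> k \<in> S" and \<sigma>f: "\<And>k. f (\<sigma> k) < d + 1 / real (Suc k)"
    by metis
  have \<sigma>C: "\<sigma> k \<in> carrier H" for k
    using \<sigma>S SC by auto
  \<comment> \<open>the midpoint of \<open>y\<close> and \<open>z\<close> lies in \<open>S\<close>, so its squared distance to \<open>x\<close> is at least \<open>d\<close>\<close>
  have near: "(hdist H y z)\<^sup>2 \<le> 2 * f y + 2 * f z - 4 * d" if "y \<in> S" "z \<in> S" for y z
  proof -
    have "(1/2) \<odot>\<^bsub>H\<^esub> (y \<oplus> z) \<in> S"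
      using that by (simp add: closed_subspace_add[OF S] closed_subspace_smult[OF S])
    then have "d \<le> f ((1/2) \<odot>\<^bsub>H\<^esub> (y \<oplus> z))"
      by (rule lower)
    then show ?thesis
      using hnorm_parallelogram[of x y z] that x SC
      by (auto simp: hdist_eq f_def subset_iff)
  qed
  have "metric.MCauchy \<sigma>"
    unfolding metric.MCauchy_def
  proof (intro conjI allI impI)
    show "range \<sigma> \<subseteq> carrier H" using \<sigma>C by auto
    fix \<epsilon> :: real assume "0 < \<epsilon>"
    then obtain N where N: "4 / \<epsilon>\<^sup>2 < real (Suc N)"
      by (metis reals_Archimedean2 less_trans of_nat_less_iff lessI)
    show "\<exists>N. \<forall>n n'. N \<le> n \<longrightarrow> N \<le> n' \<longrightarrow> hdist H (\<sigma> n) (\<sigma> n') < \<epsilon>"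
    proof (intro exI[of _ N] allI impI)
      fix n n' assume n: "N \<le> n" "N \<le> n'"
      have "1 / real (Suc n) \<le> 1 / real (Suc N)" "1 / real (Suc n') \<le> 1 / real (Suc N)"
        using n by (auto intro!: divide_left_mono)
      then have "(hdist H (\<sigma> n) (\<sigma> n'))\<^sup>2 < 4 * (1 / real (Suc N))"
        using near[OF \<sigma>S[of n] \<sigma>S[of n']] \<sigma>f[of n] \<sigma>f[of n'] by linarith
      also have "\<dots> < \<epsilon>\<^sup>2"
        using N \<open>0 < \<epsilon>\<close> by (simp add: field_simps)
      finally show "hdist H (\<sigma> n) (\<sigma> n') < \<epsilon>"
        using \<open>0 < \<epsilon>\<close> by (simp add: power2_less_imp_less)
    qed
  qed
  then obtain y where lim: "limitin metric.mtopology \<sigma> y sequentially"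
    using complete unfolding metric.mcomplete_def by blast
  have y: "y \<in> S"
    using S lim \<sigma>S unfolding closed_subspace_def metric.metric_closedin_iff_sequentially_closed
    by blast
  then have yC: "y \<in> carrier H" using SC by auto
  have dist0: "(\<lambda>k. hdist H (\<sigma> k) y) \<longlonglongrightarrow> 0"
    using lim by (simp add: metric.limitin_metric_dist_null)
  have "(\<lambda>k. sqrt (d + 1 / real (Suc k)) + hdist H (\<sigma> k) y) \<longlonglongrightarrow> sqrt (d + 0) + 0"
    by (intro tendsto_intros dist0 LIMSEQ_Suc[OF lim_1_over_n])
  moreover have "hnorm H (x \<ominus> y) \<le> sqrt (d + 1 / real (Suc k)) + hdist H (\<sigma> k) y" for k
  proof -
    have "hnorm H (x \<ominus> \<sigma> k) \<le> sqrt (d + 1 / real (Suc k))"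
      using \<sigma>f[of k] by (simp add: f_def real_le_rsqrt)
    moreover have "hnorm H (x \<ominus> y) \<le> hnorm H (x \<ominus> \<sigma> k) + hdist H (\<sigma> k) y"
      using metric.triangle[of x "\<sigma> k" y] x yC \<sigma>C by (simp add: hdist_eq)
    ultimately show ?thesis by simp
  qed
  ultimately have "hnorm H (x \<ominus> y) \<le> sqrt d"
    using LIMSEQ_le_const by fastforce
  then have min: "f y \<le> d"
    using d0 x yC power_mono[of "hnorm H (x \<ominus> y)" "sqrt d" 2] by (simp add: f_def)
  have "ip H (x \<ominus> y) z = 0" if z: "z \<in> S" for z
  proof (cases "z = \<zero>")
    case True then show ?thesis using x yC by simp
  next
    case False
    have zC: "z \<in> carrier H" using z SC by auto
    define t where "t = ip H (x \<ominus> y) z / complex_of_real ((hnorm H z)\<^sup>2)"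
    have "x \<ominus> (y \<oplus> t \<odot>\<^bsub>H\<^esub> z) = (x \<ominus> y) \<ominus> t \<odot>\<^bsub>H\<^esub> z"
      by (rule eq_if_ip_eq) (use x yC zC in \<open>auto simp: ip_expand\<close>)
    then have "f (y \<oplus> t \<odot>\<^bsub>H\<^esub> z) = f y - (cmod (ip H (x \<ominus> y) z))\<^sup>2 / (hnorm H z)\<^sup>2"
      using hnorm_sq_minus_component[of "x \<ominus> y" z] False x yC zC by (simp add: f_def t_def)
    moreover have "d \<le> f (y \<oplus> t \<odot>\<^bsub>H\<^esub> z)"
      using y z by (intro lower) (simp add: closed_subspace_add[OF S] closed_subspace_smult[OF S])
    ultimately have "(cmod (ip H (x \<ominus> y) z))\<^sup>2 / (hnorm H z)\<^sup>2 \<le> 0"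
      using min by simp
    then show ?thesis
      using False zC by (simp add: divide_le_0_iff)
  qed
  with y show ?thesis by blast
qed

lemma
  assumes S: "closed_subspace H S" and x: "x \<in> carrier H"
  shows orth_proj_in: "orth_proj H S x \<in> S"
    and orth_proj_orth: "\<And>z. z \<in> S \<Longrightarrow> ip H (x \<ominus> orth_proj H S x) z = 0"
proof -
  obtain y where "y \<in> S" "\<forall>z\<in>S. ip H (x \<ominus> y) z = 0"
    using orth_proj_exists[OF assms] by blast
  with orth_proj_eqI[OF assms this(1)]
  show "orth_proj H S x \<in> S" "\<And>z. z \<in> S \<Longrightarrow> ip H (x \<ominus> orth_proj H S x) z = 0"
    by auto
qed

end

section \<open>The Friedrichs number as a bound on Gram matrices\<close>

lemma sum_symmetric_split:
  fixes g :: "nat \<Rightarrow> nat \<Rightarrow> real"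
  assumes "\<And>i j. \<lbrakk>i \<in> {1..n}; j \<in> {1..n}\<rbrakk> \<Longrightarrow> g i j = g j i"
  shows "(\<Sum>i\<in>{1..n}. \<Sum>j\<in>{1..n}. g i j)
    = (\<Sum>i\<in>{1..n}. g i i) + 2 * (\<Sum>j\<in>{1..n}. \<Sum>i\<in>{1..<j}. g i j)"
  using assms
proof (induction n)
  case (Suc n)
  have "(\<Sum>j\<in>{1..n}. g (Suc n) j) = (\<Sum>i\<in>{1..n}. g i (Suc n))"
    by (intro sum.cong Suc.prems) auto
  moreover have "{1..<Suc n} = {1..n}" by auto
  ultimately show ?case
    using Suc by (simp add: sum.distrib)
qed simp

context complex_inner_product_space
begin

text \<open>The vector \<open>w\<close> is the sum of the \<open>x i\<close>, described by its inner products.\<close>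

lemma ex_vector_sum:
  assumes "\<And>i. i \<in> {1..n::nat} \<Longrightarrow> x i \<in> carrier H"
  shows "\<exists>w\<in>carrier H. \<forall>z\<in>carrier H. ip H w z = (\<Sum>i\<in>{1..n}. ip H (x i) z)"
  using assms
proof (induction n)
  case 0
  show ?case by (intro bexI[of _ "\<zero>"]) auto
next
  case (Suc n)
  then obtain w where "w \<in> carrier H" "\<forall>z\<in>carrier H. ip H w z = (\<Sum>i\<in>{1..n}. ip H (x i) z)"
    by force
  with Suc.prems[of "Suc n"] show ?case
    by (intro bexI[of _ "w \<oplus> x (Suc n)"]) (auto simp: ip_plus_left)
qed

text \<open>The double sum is the squared norm of the sum of the \<open>x i\<close>.\<close>

lemma gram_sum_nonneg:
  assumes x: "\<And>i. i \<in> {1..n::nat} \<Longrightarrow> x i \<in> carrier H"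
  shows "0 \<le> (\<Sum>i\<in>{1..n}. \<Sum>j\<in>{1..n}. Re (ip H (x i) (x j)))"
proof -
  obtain w where w: "w \<in> carrier H"
    and ipw: "\<And>z. z \<in> carrier H \<Longrightarrow> ip H w z = (\<Sum>i\<in>{1..n}. ip H (x i) z)"
    using ex_vector_sum[of n x] x by blast
  have "ip H (x i) w = (\<Sum>j\<in>{1..n}. ip H (x i) (x j))" if "i \<in> {1..n}" for i
  proof -
    have "ip H (x i) w = (\<Sum>j\<in>{1..n}. cnj (ip H (x j) (x i)))"
      using ip_sym[OF w x[OF that]] ipw[OF x[OF that]] by simp
    then show ?thesis
      using x that by (auto simp: ip_sym[symmetric] intro!: sum.cong)
  qed
  then have "ip H w w = (\<Sum>i\<in>{1..n}. \<Sum>j\<in>{1..n}. ip H (x i) (x j))"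
    using ipw[OF w] by simp
  then show ?thesis
    using hnorm_sq[OF w] zero_le_power2[of "hnorm H w"] by simp
qed

text \<open>This is the bound $c_F\le1$, which makes the set of Friedrichs quotients bounded.\<close>

lemma gram_sum_le:
  assumes x: "\<And>i. i \<in> {1..n::nat} \<Longrightarrow> x i \<in> carrier H"
  shows "(\<Sum>i\<in>{1..n}. \<Sum>j\<in>{1..n}. Re (ip H (x i) (x j))) \<le> real n * (\<Sum>i\<in>{1..n}. (hnorm H (x i))\<^sup>2)"
proof -
  have "2 * Re (ip H (x i) (x j)) \<le> (hnorm H (x i))\<^sup>2 + (hnorm H (x j))\<^sup>2"
    if "i \<in> {1..n}" "j \<in> {1..n}" for i j
  proof -
    have "Re (ip H (x i) (x j)) \<le> hnorm H (x i) * hnorm H (x j)"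
      using Cauchy_Schwarz[OF x[OF that(1)] x[OF that(2)]] complex_Re_le_cmod order_trans by blast
    then show ?thesis
      using sum_squares_bound[of "hnorm H (x i)" "hnorm H (x j)"] by simp
  qed
  then have "(\<Sum>i\<in>{1..n}. \<Sum>j\<in>{1..n}. 2 * Re (ip H (x i) (x j)))
      \<le> (\<Sum>i\<in>{1..n}. \<Sum>j\<in>{1..n}. (hnorm H (x i))\<^sup>2 + (hnorm H (x j))\<^sup>2)"
    by (intro sum_mono)
  also have "\<dots> = 2 * (real n * (\<Sum>i\<in>{1..n}. (hnorm H (x i))\<^sup>2))"
    by (simp add: sum.distrib sum_distrib_left)
  finally show ?thesis
    by (simp flip: sum_distrib_left)
qed

lemma friedrichs_quotient_le_iff:
  assumes n: "n \<ge> 2" and x: "\<And>i. i \<in> {1..n} \<Longrightarrow> x i \<in> carrier H"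
    and nz: "\<exists>i\<in>{1..n}. x i \<noteq> \<zero>"
  shows "2 / (real n - 1) * ((\<Sum>j\<in>{1..n}. \<Sum>i\<in>{1..<j}. Re (ip H (x i) (x j)))
        / (\<Sum>i\<in>{1..n}. (hnorm H (x i))\<^sup>2)) \<le> c
    \<longleftrightarrow> (\<Sum>i\<in>{1..n}. \<Sum>j\<in>{1..n}. Re (ip H (x i) (x j)))
        \<le> (1 + (real n - 1) * c) * (\<Sum>i\<in>{1..n}. (hnorm H (x i))\<^sup>2)"
proof -
  define N where "N = (\<Sum>i\<in>{1..n}. (hnorm H (x i))\<^sup>2)"
  define Q where "Q = (\<Sum>j\<in>{1..n}. \<Sum>i\<in>{1..<j}. Re (ip H (x i) (x j)))"
  obtain i where i: "i \<in> {1..n}" "x i \<noteq> \<zero>" using nz by blast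
  have "0 < N"
    unfolding N_def by (rule sum_pos2[OF _ i(1)]) (use i x in auto)
  have "(\<Sum>i\<in>{1..n}. \<Sum>j\<in>{1..n}. Re (ip H (x i) (x j)))
      = (\<Sum>i\<in>{1..n}. Re (ip H (x i) (x i))) + 2 * Q"
    unfolding Q_def
  proof (rule sum_symmetric_split)
    fix i j assume "i \<in> {1..n}" "j \<in> {1..n}"
    from ip_sym[OF x[OF this(1)] x[OF this(2)]]
    show "Re (ip H (x i) (x j)) = Re (ip H (x j) (x i))"
      by (metis cnj.simps(1))
  qed
  moreover have "(\<Sum>i\<in>{1..n}. Re (ip H (x i) (x i))) = N"
    using x by (simp add: N_def hnorm_sq)
  ultimately have "(\<Sum>i\<in>{1..n}. \<Sum>j\<in>{1..n}. Re (ip H (x i) (x j))) = N + 2 * Q"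
    by simp
  moreover have "2 / (real n - 1) * (Q / N) \<le> c \<longleftrightarrow> N + 2 * Q \<le> (1 + (real n - 1) * c) * N"
    using n \<open>0 < N\<close> by (simp add: pos_divide_le_eq algebra_simps)
  ultimately show ?thesis
    by (simp add: N_def Q_def)
qed

text \<open>With $T$ the double sum and $N$ the sum of squared norms, each quotient is $(T-N)/((n-1)N)$. The
  convention for an empty set of quotients fits because $c\ge0$, and a tuple of zero vectors, which has
  no quotient, satisfies the inequality trivially.\<close>

theorem friedrichs_number_le_iff:
  assumes n: "n \<ge> 2" and c: "0 \<le> c" and S: "\<And>i. i \<in> {1..n} \<Longrightarrow> S i \<subseteq> carrier H"
  shows "friedrichs_number H n S \<le> c \<longleftrightarrow>
    (\<forall>x. (\<forall>i\<in>{1..n}. x i \<in> orth_diff H (S i) (common_subspace n S)) \<longrightarrow>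
      (\<Sum>i\<in>{1..n}. \<Sum>j\<in>{1..n}. Re (ip H (x i) (x j)))
        \<le> (1 + (real n - 1) * c) * (\<Sum>i\<in>{1..n}. (hnorm H (x i))\<^sup>2))"
    (is "_ \<longleftrightarrow> (\<forall>x. ?D x \<longrightarrow> ?T x \<le> ?k * ?N x)")
proof -
  let ?Q = "friedrichs_quotients H n S"
  let ?q = "\<lambda>x. 2 / (real n - 1) * ((\<Sum>j\<in>{1..n}. \<Sum>i\<in>{1..<j}. Re (ip H (x i) (x j))) / ?N x)"
  have D: "x i \<in> carrier H" if "?D x" "i \<in> {1..n}" for x i
    using that(1) S[OF that(2)] that(2) unfolding orth_diff_def by blast
  have Q: "?Q = {?q x | x. ?D x \<and> (\<exists>i\<in>{1..n}. x i \<noteq> \<zero>)}"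
    by (simp add: friedrichs_quotients_def)
  have bdd: "bdd_above ?Q"
  proof (rule bdd_aboveI[of _ 1])
    fix q assume "q \<in> ?Q"
    then obtain x where x: "q = ?q x" "?D x" "\<exists>i\<in>{1..n}. x i \<noteq> \<zero>" unfolding Q by blast
    have "?T x \<le> (1 + (real n - 1) * 1) * ?N x"
      using gram_sum_le[of n x] D[OF x(2)] by simp
    then show "q \<le> 1"
      unfolding x(1) using friedrichs_quotient_le_iff[OF n _ x(3), of 1] D[OF x(2)] by blast
  qed
  have "friedrichs_number H n S \<le> c \<longleftrightarrow> (\<forall>q\<in>?Q. q \<le> c)"
    using c cSup_le_iff[OF _ bdd, of c] by (auto simp: friedrichs_number_def)
  also have "\<dots> \<longleftrightarrow> (\<forall>x. ?D x \<and> (\<exists>i\<in>{1..n}. x i \<noteq> \<zero>) \<longrightarrow> ?q x \<le> c)"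
    unfolding Q by auto
  also have "\<dots> \<longleftrightarrow> (\<forall>x. ?D x \<and> (\<exists>i\<in>{1..n}. x i \<noteq> \<zero>) \<longrightarrow> ?T x \<le> ?k * ?N x)"
  proof (intro all_cong)
    fix x assume "?D x \<and> (\<exists>i\<in>{1..n}. x i \<noteq> \<zero>)"
    then show "?q x \<le> c \<longleftrightarrow> ?T x \<le> ?k * ?N x"
      using D by (intro friedrichs_quotient_le_iff[OF n]) blast+
  qed
  also have "\<dots> \<longleftrightarrow> (\<forall>x. ?D x \<longrightarrow> ?T x \<le> ?k * ?N x)"
  proof -
    have "?T x \<le> ?k * ?N x" if "\<not> (\<exists>i\<in>{1..n}. x i \<noteq> \<zero>)" for x
      using that by simp
    then show ?thesis by blast
  qed
  finally show ?thesis .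
qed

end

section \<open>Admissible matrices\<close>

definition quad_form :: "nat \<Rightarrow> (nat \<Rightarrow> nat \<Rightarrow> complex) \<Rightarrow> (nat \<Rightarrow> complex) \<Rightarrow> complex" where
  "quad_form n a v = (\<Sum>i<n. \<Sum>j<n. a i j * v j * cnj (v i))"

text \<open>The conditions defining \<open>admissible_mats\<close>, read as conditions on the entries. Only real parts
  are mentioned, as a Hermitian form takes real values. Functions are used in place of matrices because
  they carry the product topology.\<close>

definition admissible :: "nat \<Rightarrow> real \<Rightarrow> (nat \<Rightarrow> nat \<Rightarrow> complex) \<Rightarrow> bool" where
  "admissible n c a \<longleftrightarrow>
     (\<forall>i<n. \<forall>j<n. a j i = cnj (a i j)) \<and> (\<forall>i<n. a i i = 1) \<and>
     (\<forall>v. 0 \<le> Re (quad_form n a v)) \<and>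
     (\<forall>v. Re (quad_form n a v) \<le> (1 + (real n - 1) * c) * (\<Sum>i<n. (cmod (v i))\<^sup>2))"

lemma quad_form_cong:
  assumes "\<And>i j. \<lbrakk>i < n; j < n\<rbrakk> \<Longrightarrow> a i j = b i j" "\<And>i. i < n \<Longrightarrow> v i = w i"
  shows "quad_form n a v = quad_form n b w"
  using assms by (simp add: quad_form_def)

lemma quad_form_diff: "quad_form n (\<lambda>i j. a i j - b i j) v = quad_form n a v - quad_form n b v"
  by (simp add: quad_form_def algebra_simps sum_subtractf)

lemma quad_form_scaled_identity:
  "quad_form n (\<lambda>i j. if i = j then k else 0) v = k * complex_of_real (\<Sum>i<n. (cmod (v i))\<^sup>2)"
proof -
  have "(\<Sum>j<n. (if i = j then k else 0) * v j * cnj (v i)) = k * complex_of_real ((cmod (v i))\<^sup>2)"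
    if "i < n" for i
  proof -
    have "(\<Sum>j<n. (if i = j then k else 0) * v j * cnj (v i)) = (\<Sum>j<n. if i = j then k * v j * cnj (v i) else 0)"
      by (intro sum.cong) auto
    also have "\<dots> = k * (v i * cnj (v i))"
      using that by (simp add: mult.assoc)
    finally show ?thesis
      using complex_norm_square[of "v i"] by simp
  qed
  then show ?thesis
    by (simp add: quad_form_def sum_distrib_left)
qed

lemma quad_form_cnj:
  assumes "\<And>i j. \<lbrakk>i < n; j < n\<rbrakk> \<Longrightarrow> a j i = cnj (a i j)"
  shows "cnj (quad_form n a v) = quad_form n a v"
proof -
  have "cnj (quad_form n a v) = (\<Sum>i<n. \<Sum>j<n. a j i * v i * cnj (v j))"
    unfolding quad_form_def cnj_sum
  proof (intro sum.cong refl)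
    fix i j assume "i \<in> {..<n}" "j \<in> {..<n}"
    then have "a j i = cnj (a i j)" by (intro assms) auto
    then show "cnj (a i j * v j * cnj (v i)) = a j i * v i * cnj (v j)"
      by simp
  qed
  also have "\<dots> = quad_form n a v"
    unfolding quad_form_def by (rule sum.swap)
  finally show ?thesis .
qed

lemma hermitian_mat_iff:
  "hermitian_mat n A \<longleftrightarrow> A \<in> carrier_mat n n \<and> (\<forall>i<n. \<forall>j<n. A $$ (j, i) = cnj (A $$ (i, j)))"
proof -
  have "mat_adjoint A = A \<longleftrightarrow> (\<forall>i<n. \<forall>j<n. A $$ (j, i) = cnj (A $$ (i, j)))"
    if A: "A \<in> carrier_mat n n"
  proof -
    have ent: "mat_adjoint A $$ (i, j) = cnj (A $$ (j, i))" if "i < n" "j < n" for i j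
      using A that by (simp add: mat_adjoint_def mat_of_rows_def)
    have dim: "dim_row (mat_adjoint A) = n" "dim_col (mat_adjoint A) = n"
      using A by (auto simp: mat_adjoint_def)
    show ?thesis
    proof
      assume "mat_adjoint A = A"
      then show "\<forall>i<n. \<forall>j<n. A $$ (j, i) = cnj (A $$ (i, j))"
        using ent by metis
    next
      assume "\<forall>i<n. \<forall>j<n. A $$ (j, i) = cnj (A $$ (i, j))"
      then have "mat_adjoint A $$ (i, j) = A $$ (i, j)" if "i < n" "j < n" for i j
        using that ent[OF that] by metis
      then show "mat_adjoint A = A"
        using A dim by (intro eq_matI) auto
    qed
  qed
  then show ?thesis
    by (auto simp: hermitian_mat_def)
qed

lemma psd_mat_iff:
  "psd_mat n A \<longleftrightarrow> hermitian_mat n A \<and> (\<forall>v. 0 \<le> Re (quad_form n (\<lambda>i j. A $$ (i, j)) v))"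
proof (cases "hermitian_mat n A")
  case True
  let ?a = "\<lambda>i j. A $$ (i, j)"
  have A: "A \<in> carrier_mat n n" and h: "\<And>i j. \<lbrakk>i < n; j < n\<rbrakk> \<Longrightarrow> ?a j i = cnj (?a i j)"
    using True unfolding hermitian_mat_iff by blast+
  have eq: "(A *\<^sub>v v) \<bullet>c v = quad_form n ?a (\<lambda>i. v $ i)" if "v \<in> carrier_vec n" for v
    using A that by (simp add: quad_form_def scalar_prod_def row_def sum_distrib_right
        lessThan_atLeast0)
  have im: "Im (quad_form n ?a v) = 0" for v
    using quad_form_cnj[of n ?a v, OF h] by (simp add: complex_eq_iff)
  have "0 \<le> Re (quad_form n ?a v)" if "\<forall>v\<in>carrier_vec n. 0 \<le> (A *\<^sub>v v) \<bullet>c v" for v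
  proof -
    have "quad_form n ?a v = quad_form n ?a (\<lambda>i. vec n v $ i)"
      by (rule quad_form_cong) auto
    then show ?thesis
      using that[rule_format, of "vec n v"] by (simp add: eq less_eq_complex_def)
  qed
  moreover have "0 \<le> (A *\<^sub>v v) \<bullet>c v"
    if "\<forall>v. 0 \<le> Re (quad_form n ?a v)" "v \<in> carrier_vec n" for v
    using that by (simp add: eq im less_eq_complex_def)
  ultimately show ?thesis
    using True by (auto simp: psd_mat_def)
qed (simp add: psd_mat_def)

lemma admissible_mats_iff:
  "A \<in> admissible_mats n c \<longleftrightarrow> A \<in> carrier_mat n n \<and> admissible n c (\<lambda>i j. A $$ (i, j))"
proof (cases "hermitian_mat n A")
  case True
  let ?a = "\<lambda>i j. A $$ (i, j)"
  let ?k = "complex_of_real (1 + (real n - 1) * c)"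
  have A: "A \<in> carrier_mat n n" and h: "\<forall>i<n. \<forall>j<n. ?a j i = cnj (?a i j)"
    using True unfolding hermitian_mat_iff by blast+
  have 1: "A - 0\<^sub>m n n = A"
    using A by auto
  let ?B = "?k \<cdot>\<^sub>m 1\<^sub>m n - A"
  have B: "hermitian_mat n ?B"
    unfolding hermitian_mat_iff
  proof (intro conjI allI impI)
    fix i j assume ij: "i < n" "j < n"
    have "?a j i = cnj (?a i j)" using h ij by blast
    then show "?B $$ (j, i) = cnj (?B $$ (i, j))"
      using A ij by auto
  qed (use A in auto)
  have "quad_form n (\<lambda>i j. ?B $$ (i, j)) v
      = ?k * complex_of_real (\<Sum>i<n. (cmod (v i))\<^sup>2) - quad_form n ?a v" for v
  proof -
    have "quad_form n (\<lambda>i j. ?B $$ (i, j)) v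
        = quad_form n (\<lambda>i j. (if i = j then ?k else 0) - ?a i j) v"
      using A by (intro quad_form_cong) auto
    then show ?thesis
      by (simp only: quad_form_diff quad_form_scaled_identity)
  qed
  then have "psd_mat n ?B \<longleftrightarrow>
      (\<forall>v. Re (quad_form n ?a v) \<le> (1 + (real n - 1) * c) * (\<Sum>i<n. (cmod (v i))\<^sup>2))"
    using B by (simp add: psd_mat_iff flip: of_real_mult del: of_real_sum)
  then have "A \<in> admissible_mats n c \<longleftrightarrow> (\<forall>i<n. ?a i i = 1) \<and>
      (\<forall>v. 0 \<le> Re (quad_form n ?a v)) \<and>
      (\<forall>v. Re (quad_form n ?a v) \<le> (1 + (real n - 1) * c) * (\<Sum>i<n. (cmod (v i))\<^sup>2))"
    using True by (simp add: admissible_mats_def loewner_le_def 1 psd_mat_iff[of n A])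
  then show ?thesis
    using A h unfolding admissible_def by blast
next
  case False
  then show ?thesis
    unfolding admissible_mats_def admissible_def hermitian_mat_iff by blast
qed

lemma admissible_cong:
  assumes eq: "\<And>i j. \<lbrakk>i < n; j < n\<rbrakk> \<Longrightarrow> a i j = b i j"
  shows "admissible n c a \<longleftrightarrow> admissible n c b"
proof -
  have q: "quad_form n a = quad_form n b"
    by (intro ext quad_form_cong eq refl)
  have h: "(\<forall>i<n. \<forall>j<n. a j i = cnj (a i j)) \<longleftrightarrow> (\<forall>i<n. \<forall>j<n. b j i = cnj (b i j))"
    using eq by metis
  have d: "(\<forall>i<n. a i i = 1) \<longleftrightarrow> (\<forall>i<n. b i i = 1)"
    using eq by metis
  show ?thesis
    unfolding admissible_def q h d ..
qed

lemma admissible_mat: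
  assumes "admissible n c a"
  shows "mat n n (\<lambda>(i, j). a i j) \<in> admissible_mats n c"
  using assms admissible_cong[of n "\<lambda>i j. mat n n (\<lambda>(i, j). a i j) $$ (i, j)" a c]
  by (simp add: admissible_mats_iff)

text \<open>Nonnegativity of the form on a vector supported on \<open>i\<close> and \<open>j\<close>, with the phase \<open>s\<close> chosen such
  that \<open>s * a i j\<close> is negative.\<close>

lemma admissible_entry_le_1:
  assumes a: "admissible n c a" and ij: "i < n" "j < n"
  shows "cmod (a i j) \<le> 1"
proof (cases "i = j \<or> a i j = 0")
  case True
  have "a i i = 1"
    using a ij(1) unfolding admissible_def by blast
  with True show ?thesis by auto
next
  case False
  define s where "s = - cnj (a i j) / complex_of_real (cmod (a i j))"
  define v where "v k = (if k = i then 1 else 0) + (if k = j then s else 0)" for k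
  have sa: "s * a i j = - complex_of_real (cmod (a i j))"
    using False by (simp add: s_def complex_norm_square[symmetric] mult.commute[of "cnj _"]
        power2_eq_square)
  have "cmod s = 1"
    using False by (simp add: s_def norm_divide)
  then have ss: "s * cnj s = 1"
    by (simp add: complex_norm_square[symmetric])
  have row: "(\<Sum>l<n. a k l * v l * w) = (a k i + a k j * s) * w" for k w
  proof -
    have "(\<Sum>l<n. a k l * v l * w)
        = (\<Sum>l<n. (if l = i then a k l * w else 0) + (if l = j then a k l * s * w else 0))"
      by (intro sum.cong) (auto simp: v_def algebra_simps)
    then show ?thesis
      using ij by (simp add: sum.distrib algebra_simps)
  qed
  have "quad_form n a v = (\<Sum>k<n. (if k = i then a k i + a k j * s else 0)
      + (if k = j then (a k i + a k j * s) * cnj s else 0))"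
    unfolding quad_form_def row by (intro sum.cong) (auto simp: v_def algebra_simps)
  also have "\<dots> = (a i i + a i j * s) + (a j i + a j j * s) * cnj s"
    using ij by (simp add: sum.distrib)
  also have "\<dots> = 2 + s * a i j + cnj (s * a i j)"
  proof -
    have "a j i = cnj (a i j)" "a i i = 1" "a j j = 1"
      using a ij unfolding admissible_def by blast+
    then show ?thesis
      using ss by (simp add: algebra_simps)
  qed
  finally have "Re (quad_form n a v) = 2 - 2 * cmod (a i j)"
    by (simp add: sa)
  moreover have "0 \<le> Re (quad_form n a v)"
    using a unfolding admissible_def by blast
  ultimately show ?thesis
    by simp
qed

lemma admissible_identity:
  assumes "1 \<le> n" "0 \<le> c"
  shows "admissible n c (\<lambda>i j. if i = j then 1 else 0)"
proof -
  have "x \<le> (1 + (real n - 1) * c) * x" if "0 \<le> x" for x :: real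
    using assms that by (simp add: mult_le_cancel_right1 distrib_right)
  then show ?thesis
    by (simp add: admissible_def quad_form_scaled_identity sum_nonneg)
qed

text \<open>Extended by zero outside the square of indices below \<open>n\<close>, the admissible kernels form a closed subset
  of a product of closed unit discs, which is compact by Tychonoff.\<close>

theorem admissible_attains_max:
  assumes "1 \<le> n" "0 \<le> c"
  obtains a where "admissible n c a"
    "\<And>b. admissible n c b \<Longrightarrow> cmod (\<Prod>i<n - 1. b i (Suc i)) \<le> cmod (\<Prod>i<n - 1. a i (Suc i))"
proof -
  define K where "K = {p :: nat \<times> nat \<Rightarrow> complex. admissible n c (\<lambda>i j. p (i, j)) \<and>
    (\<forall>i j. i < n \<and> j < n \<or> p (i, j) = 0)}"
  have cont: "continuous_on UNIV (\<lambda>p :: nat \<times> nat \<Rightarrow> complex. p q)" for q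
    by (rule continuous_on_product_coordinates)
  have "closed K"
    unfolding K_def admissible_def quad_form_def
    by (intro closed_Collect_conj closed_Collect_all closed_Collect_imp open_Collect_const
        closed_Collect_disj closed_Collect_const closed_Collect_eq closed_Collect_le
        continuous_intros cont)
  have "compact (PiE UNIV (\<lambda>_ :: nat \<times> nat. cball (0 :: complex) 1))"
    using compactin_PiE[of "\<lambda>_. euclidean" UNIV "\<lambda>_ :: nat \<times> nat. cball (0 :: complex) 1"]
    by (simp add: euclidean_product_topology)
  moreover have "K \<subseteq> PiE UNIV (\<lambda>_ :: nat \<times> nat. cball (0 :: complex) 1)"
  proof
    fix p assume p: "p \<in> K"
    have "i < n \<and> j < n \<or> p (i, j) = 0" for i j
      using p by (simp add: K_def)
    then have "cmod (p (i, j)) \<le> 1" for i j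
      using p admissible_entry_le_1[of n c "\<lambda>i j. p (i, j)" i j]
      by (cases "i < n \<and> j < n") (simp add: K_def, metis norm_zero zero_le_one)
    then show "p \<in> PiE UNIV (\<lambda>_ :: nat \<times> nat. cball (0 :: complex) 1)"
      by auto
  qed
  ultimately have "compact K"
    using \<open>closed K\<close> by (metis compact_Int_closed Int_absorb1)
  have inK: "(\<lambda>(i, j). if i < n \<and> j < n then b i j else 0) \<in> K" if "admissible n c b" for b
    using that admissible_cong[of n "\<lambda>i j. if i < n \<and> j < n then b i j else 0" b c]
    by (simp add: K_def)
  have "K \<noteq> {}"
    using inK[OF admissible_identity[OF assms]] by blast
  have "continuous_on K (\<lambda>p. cmod (\<Prod>i<n - 1. p (i, Suc i)))"
    by (intro continuous_intros continuous_on_subset[OF cont]) auto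
  from continuous_attains_sup[OF \<open>compact K\<close> \<open>K \<noteq> {}\<close> this]
  obtain p where p: "p \<in> K" and
    max: "\<forall>q\<in>K. cmod (\<Prod>i<n - 1. q (i, Suc i)) \<le> cmod (\<Prod>i<n - 1. p (i, Suc i))" by auto
  show ?thesis
  proof (rule that[of "\<lambda>i j. p (i, j)"])
    show "admissible n c (\<lambda>i j. p (i, j))"
      using p by (simp add: K_def)
    fix b assume b: "admissible n c b"
    have "(\<Prod>i<n - 1. b i (Suc i))
        = (\<Prod>i<n - 1. (\<lambda>(i, j). if i < n \<and> j < n then b i j else 0) (i, Suc i))"
      by (intro prod.cong) auto
    with max[rule_format, OF inK[OF b]]
    show "cmod (\<Prod>i<n - 1. b i (Suc i)) \<le> cmod (\<Prod>i<n - 1. p (i, Suc i))"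
      by simp
  qed
qed

section \<open>The upper bound\<close>

lemma prod_ratio_telescope:
  fixes h :: "nat \<Rightarrow> real"
  assumes "\<And>k. \<lbrakk>1 \<le> k; k \<le> Suc m\<rbrakk> \<Longrightarrow> h k \<noteq> 0"
  shows "(\<Prod>i<m. h (Suc (Suc i)) / h (Suc i)) = h (Suc m) / h 1"
  using assms by (induction m) auto

text \<open>The hypothesis says that \<open>x - y\<close> is orthogonal to \<open>y\<close>, as for a projection \<open>y\<close> of \<open>x\<close>.\<close>

lemma (in complex_inner_product_space) hnorm_le_if_ip_eq_self:
  assumes x: "x \<in> carrier H" and y: "y \<in> carrier H" and "ip H x y = ip H y y"
  shows "hnorm H y \<le> hnorm H x"
proof (cases "y = \<zero>")
  case False
  then have "0 < hnorm H y"
    using y by (simp add: less_le)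
  moreover have "hnorm H y * hnorm H y \<le> hnorm H x * hnorm H y"
    using Cauchy_Schwarz[OF x y] assms(3) by (simp add: ip_self[OF y] power2_eq_square norm_mult)
  ultimately show ?thesis by simp
qed (use x in simp)

context complex_inner_product_space
begin

text \<open>The factors in the kernel are swapped, because the inner product is linear in its first argument
  while the matrix acts on the column index.\<close>

lemma quad_form_gram:
  assumes "\<And>i. i \<in> {1..n} \<Longrightarrow> u i \<in> carrier H"
  shows "Re (quad_form n (\<lambda>i j. ip H (u (Suc j)) (u (Suc i))) v) =
    (\<Sum>i\<in>{1..n}. \<Sum>j\<in>{1..n}. Re (ip H (v (i - 1) \<odot>\<^bsub>H\<^esub> u i) (v (j - 1) \<odot>\<^bsub>H\<^esub> u j)))"
proof -
  have "quad_form n (\<lambda>i j. ip H (u (Suc j)) (u (Suc i))) v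
      = (\<Sum>i<n. \<Sum>j<n. ip H (v j \<odot>\<^bsub>H\<^esub> u (Suc j)) (v i \<odot>\<^bsub>H\<^esub> u (Suc i)))"
    unfolding quad_form_def using assms
    by (intro sum.cong refl) (simp add: ip_scale_left ip_scale_right mult_ac)
  also have "\<dots> = (\<Sum>j<n. \<Sum>i<n. ip H (v j \<odot>\<^bsub>H\<^esub> u (Suc j)) (v i \<odot>\<^bsub>H\<^esub> u (Suc i)))"
    by (rule sum.swap)
  finally show ?thesis
    by (simp add: sum.atLeast1_atMost_eq)
qed

text \<open>Scaling the \<open>u i\<close> by arbitrary coefficients gives a tuple to which the bound of
  \<open>friedrichs_number_le_iff\<close> applies; both of its sides are quadratic forms in the coefficients.\<close>

lemma admissible_gram:
  assumes n: "n \<ge> 2" and c: "0 \<le> c" and S: "\<And>i. i \<in> {1..n} \<Longrightarrow> closed_subspace H (S i)"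
    and F: "friedrichs_number H n S \<le> c"
    and u: "\<And>i. i \<in> {1..n} \<Longrightarrow> u i \<in> orth_diff H (S i) (common_subspace n S)"
    and unit: "\<And>i. i \<in> {1..n} \<Longrightarrow> hnorm H (u i) = 1"
  shows "admissible n c (\<lambda>i j. ip H (u (Suc j)) (u (Suc i)))"
proof -
  have SC: "S i \<subseteq> carrier H" if "i \<in> {1..n}" for i
    using closed_subspace_subset[OF S[OF that]] .
  have uC: "u i \<in> carrier H" if "i \<in> {1..n}" for i
    using SC[OF that] u[OF that] by (auto simp: orth_diff_def)
  have H0: "common_subspace n S \<subseteq> carrier H"
    using SC[of 1] n by (auto simp: common_subspace_def)
  have herm: "ip H (u (Suc i)) (u (Suc j)) = cnj (ip H (u (Suc j)) (u (Suc i)))"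
    if "i < n" "j < n" for i j
    using that by (intro ip_sym uC) auto
  have diag: "ip H (u (Suc i)) (u (Suc i)) = 1" if "i < n" for i
    using that uC[of "Suc i"] unit[of "Suc i"] by (simp add: ip_self)
  have gram: "Re (quad_form n (\<lambda>i j. ip H (u (Suc j)) (u (Suc i))) v) =
    (\<Sum>i\<in>{1..n}. \<Sum>j\<in>{1..n}. Re (ip H (v (i - 1) \<odot>\<^bsub>H\<^esub> u i) (v (j - 1) \<odot>\<^bsub>H\<^esub> u j)))" for v
    by (rule quad_form_gram) (rule uC)
  have le: "Re (quad_form n (\<lambda>i j. ip H (u (Suc j)) (u (Suc i))) v)
      \<le> (1 + (real n - 1) * c) * (\<Sum>i<n. (cmod (v i))\<^sup>2)" for v
  proof -
    let ?x = "\<lambda>i. v (i - 1) \<odot>\<^bsub>H\<^esub> u i"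
    have "?x i \<in> orth_diff H (S i) (common_subspace n S)" if i: "i \<in> {1..n}" for i
    proof -
      have "ip H (?x i) z = 0" if "z \<in> common_subspace n S" for z
        using u[OF i] uC[OF i] H0 that by (auto simp: orth_diff_def ip_scale_left)
      moreover have "?x i \<in> S i"
        using u[OF i] by (simp add: orth_diff_def closed_subspace_smult[OF S[OF i]])
      ultimately show ?thesis
        by (simp add: orth_diff_def)
    qed
    then have "(\<Sum>i\<in>{1..n}. \<Sum>j\<in>{1..n}. Re (ip H (?x i) (?x j)))
        \<le> (1 + (real n - 1) * c) * (\<Sum>i\<in>{1..n}. (hnorm H (?x i))\<^sup>2)"
      by (intro friedrichs_number_le_iff[THEN iffD1, rule_format, OF n c SC F])
    also have "(\<Sum>i\<in>{1..n}. (hnorm H (?x i))\<^sup>2) = (\<Sum>i\<in>{1..n}. (cmod (v (i - 1)))\<^sup>2)"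
      using uC unit by (intro sum.cong refl) (simp add: hnorm_smult)
    also have "\<dots> = (\<Sum>i<n. (cmod (v i))\<^sup>2)"
      by (simp add: sum.atLeast1_atMost_eq)
    finally show ?thesis
      by (simp only: gram)
  qed
  have ge: "0 \<le> Re (quad_form n (\<lambda>i j. ip H (u (Suc j)) (u (Suc i))) v)" for v
    unfolding gram using uC by (intro gram_sum_nonneg) simp
  show ?thesis
    unfolding admissible_def using herm diag le ge by blast
qed

end

context complex_hilbert_space
begin

text \<open>The kernel is the Gram matrix of the normalised vectors $y_k=P_k\cdots P_1x-P_0x$; if $y_n=0$ the
  identity kernel will do.\<close>

theorem proj_product_bound:
  assumes n: "n \<ge> 2" and c: "0 \<le> c" and S: "\<And>i. i \<in> {1..n} \<Longrightarrow> closed_subspace H (S i)"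
    and F: "friedrichs_number H n S \<le> c"
    and x: "x \<in> carrier H" and x1: "hnorm H x \<le> 1"
  shows "\<exists>a. admissible n c a \<and>
    hnorm H (proj_product H S n x \<ominus> orth_proj H (common_subspace n S) x)
      \<le> cmod (\<Prod>i<n - 1. a i (Suc i))"
proof -
  let ?H0 = "common_subspace n S"
  define p where "p k = proj_product H S k x" for k
  define q where "q = orth_proj H ?H0 x"
  define y where "y k = p k \<ominus> q" for k
  have H0: "closed_subspace H ?H0"
    using n S by (intro closed_subspace_common) auto
  have H0S: "?H0 \<subseteq> S i" if "i \<in> {1..n}" for i
    using that by (auto simp: common_subspace_def)
  have SC: "S i \<subseteq> carrier H" if "i \<in> {1..n}" for i
    using closed_subspace_subset[OF S[OF that]] .
  have H0C: "?H0 \<subseteq> carrier H"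
    using closed_subspace_subset[OF H0] .
  have q: "q \<in> ?H0" and q_orth: "\<And>z. z \<in> ?H0 \<Longrightarrow> ip H (x \<ominus> q) z = 0"
    unfolding q_def using orth_proj_in[OF H0 x] orth_proj_orth[OF H0 x] by auto
  have qC: "q \<in> carrier H" using q H0C by blast
  have pC: "p k \<in> carrier H" if "k \<le> n" for k
    using that
  proof (induction k)
    case 0 then show ?case by (simp add: p_def x)
  next
    case (Suc k)
    then have "p (Suc k) \<in> S (Suc k)"
      unfolding p_def by (simp add: orth_proj_in S)
    then show ?case using SC[of "Suc k"] Suc.prems by auto
  qed
  have pS: "p (Suc k) \<in> S (Suc k)"
    and p_orth: "\<And>z. z \<in> S (Suc k) \<Longrightarrow> ip H (p k \<ominus> p (Suc k)) z = 0" if "k < n" for k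
    using orth_proj_in[OF S[of "Suc k"] pC[of k]] orth_proj_orth[OF S[of "Suc k"] pC[of k]] that
    by (auto simp: p_def)
  have yC: "y k \<in> carrier H" if "k \<le> n" for k
    using pC[OF that] qC by (simp add: y_def)
  have yS: "y (Suc k) \<in> S (Suc k)" if "k < n" for k
    unfolding y_def using that pS[OF that] q H0S[of "Suc k"]
    by (intro closed_subspace_minus[OF S]) auto
  have y_orth: "ip H (y k) z = 0" if "k \<le> n" "z \<in> ?H0" for k z
    using that
  proof (induction k)
    case 0 then show ?case using q_orth by (simp add: y_def p_def)
  next
    case (Suc k)
    then have "ip H (p k \<ominus> p (Suc k)) z = 0"
      using H0S[of "Suc k"] by (intro p_orth) auto
    with Suc show ?case
      using pC[of k] pC[of "Suc k"] qC H0C by (auto simp: y_def ip_minus_left subset_iff)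
  qed
  \<comment> \<open>\<open>y (Suc k)\<close> is the projection of \<open>y k\<close> onto \<open>S (Suc k)\<close>, since both differ from the partial
    products by the same vector\<close>
  have step: "ip H (y k) (y (Suc k)) = ip H (y (Suc k)) (y (Suc k))" if "k < n" for k
    using p_orth[OF that yS[OF that]] pC[of k] pC[of "Suc k"] yC[of "Suc k"] qC that
    by (simp add: y_def[of k] y_def[of "Suc k"] ip_minus_left)
  have mono: "hnorm H (y (Suc k)) \<le> hnorm H (y k)" if "k < n" for k
    using that step[OF that] by (intro hnorm_le_if_ip_eq_self yC) auto
  have "hnorm H (y 0) \<le> hnorm H x"
  proof (rule hnorm_le_if_ip_eq_self[OF x yC])
    have "ip H q (y 0) = 0"
      using y_orth[of 0 q] ip_sym[of "y 0" q] q qC yC[of 0] by simp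
    then show "ip H x (y 0) = ip H (y 0) (y 0)"
      using x qC yC[of 0] by (simp add: y_def p_def ip_minus_left)
  qed simp
  then have y1: "hnorm H (y 1) \<le> 1"
    using mono[of 0] n x1 by simp
  have mono_n: "hnorm H (y n) \<le> hnorm H (y k)" if "k \<le> n" for k
    using that by (induction rule: inc_induct) (use mono in \<open>auto intro: order_trans\<close>)
  show ?thesis
  proof (cases "y n = \<zero>")
    case True
    then show ?thesis
      using admissible_identity[of n c] n c by (intro exI conjI) (auto simp: y_def p_def q_def)
  next
    case False
    define h where "h k = hnorm H (y k)" for k
    have "0 < hnorm H (y n)"
      using yC[of n] False by (simp add: less_le)
    then have h: "0 < h k" if "k \<le> n" for k
      using mono_n[OF that] by (simp add: h_def)
    define u where "u k = complex_of_real (1 / h k) \<odot>\<^bsub>H\<^esub> y k" for k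
    have uD: "u i \<in> orth_diff H (S i) ?H0" if i: "i \<in> {1..n}" for i
    proof -
      obtain k where k: "i = Suc k" "k < n"
        using i by (cases i) auto
      have "u i \<in> S i"
        unfolding u_def using i yS[OF k(2)] by (intro closed_subspace_smult[OF S]) (auto simp: k)
      moreover have "ip H (u i) z = 0" if "z \<in> ?H0" for z
        using y_orth[of i z] yC[of i] H0C i that by (auto simp: u_def ip_scale_left)
      ultimately show ?thesis by (simp add: orth_diff_def)
    qed
    have "hnorm H (u i) = 1" if "i \<in> {1..n}" for i
      using h[of i] yC[of i] that by (simp add: u_def hnorm_smult norm_divide flip: h_def)
    then have adm: "admissible n c (\<lambda>i j. ip H (u (Suc j)) (u (Suc i)))"
      using uD by (intro admissible_gram[OF n c S F]) auto
    have "cmod (ip H (u (Suc (Suc i))) (u (Suc i))) = h (Suc (Suc i)) / h (Suc i)" if "i < n - 1" for i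
    proof -
      let ?j = "Suc i"
      have C: "y ?j \<in> carrier H" "y (Suc ?j) \<in> carrier H" and j: "?j < n"
        using that by (auto intro: yC)
      have "ip H (y (Suc ?j)) (y ?j) = complex_of_real ((h (Suc ?j))\<^sup>2)"
        using ip_sym[OF C] step[OF j] ip_self[OF C(2)] by (simp add: h_def)
      then show ?thesis
        using C h[of ?j] h[of "Suc ?j"] j
        by (simp add: u_def ip_scale_left ip_scale_right norm_mult norm_divide power2_eq_square)
    qed
    then have "cmod (\<Prod>i<n - 1. ip H (u (Suc (Suc i))) (u (Suc i)))
        = (\<Prod>i<n - 1. h (Suc (Suc i)) / h (Suc i))"
      by (simp add: prod_norm[symmetric])
    also have "\<dots> = h n / h 1"
      using prod_ratio_telescope[of "n - 1" h] h n by (simp add: less_le)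
    finally have "h n \<le> cmod (\<Prod>i<n - 1. ip H (u (Suc (Suc i))) (u (Suc i)))"
      using h[of 1] h[of n] y1 n by (simp add: h_def pos_le_divide_eq mult_left_le)
    then show ?thesis
      by (intro exI[of _ "\<lambda>i j. ip H (u (Suc j)) (u (Suc i))"] conjI adm)
        (simp add: h_def y_def p_def q_def)
  qed
qed

end

section \<open>A Hilbert space with prescribed Gram matrix\<close>

lemma ex_inj_pair: "\<exists>f :: complex \<times> complex \<Rightarrow> complex. inj f"
proof -
  have "infinite (UNIV :: complex set)"
    by (simp add: infinite_UNIV_char_0)
  from card_of_Times_same_infinite[OF this]
  obtain f where "bij_betw f (UNIV \<times> UNIV :: (complex \<times> complex) set) (UNIV :: complex set)"
    unfolding card_of_ordIso[symmetric] by blast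
  then show ?thesis
    by (auto simp: bij_betw_def)
qed

text \<open>Points of $\mathbb{C}^n$, as sequences that vanish from index \<open>n\<close> on.\<close>

definition coord_space :: "nat \<Rightarrow> (nat \<Rightarrow> complex) set" where
  "coord_space n = {v. \<forall>i\<ge>n. v i = 0}"

lemma ex_inj_coord_space: "\<exists>f :: (nat \<Rightarrow> complex) \<Rightarrow> complex. inj_on f (coord_space n)"
proof (induction n)
  case 0
  have "coord_space 0 = {\<lambda>_. 0}"
    by (auto simp: coord_space_def)
  then show ?case by simp
next
  case (Suc n)
  then obtain f :: "(nat \<Rightarrow> complex) \<Rightarrow> complex" where f: "inj_on f (coord_space n)" by blast
  obtain g :: "complex \<times> complex \<Rightarrow> complex" where g: "inj g" using ex_inj_pair by blast
  have "inj_on (\<lambda>v. g (v n, f (v(n := 0)))) (coord_space (Suc n))"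
  proof (rule inj_onI)
    fix v w assume v: "v \<in> coord_space (Suc n)" and w: "w \<in> coord_space (Suc n)"
      and "g (v n, f (v(n := 0))) = g (w n, f (w(n := 0)))"
    then have "v n = w n" and "f (v(n := 0)) = f (w(n := 0))"
      using injD[OF g] by auto
    moreover have "v(n := 0) \<in> coord_space n" "w(n := 0) \<in> coord_space n"
      using v w by (auto simp: coord_space_def Suc_le_eq)
    ultimately have "v(n := 0) = w(n := 0)" "v n = w n"
      using inj_onD[OF f] by auto
    then show "v = w"
      by (metis fun_upd_triv fun_upd_upd)
  qed
  then show ?case by blast
qed

text \<open>Since $\mathbb{C}\times\mathbb{C}$ has the cardinality of $\mathbb{C}$, so does $\mathbb{C}^n$;
  constant functions then provide room for $\mathbb{C}^n$ in the type of points, whatever \<open>'a\<close> is.\<close>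

lemma ex_coord_embedding: "\<exists>e :: (nat \<Rightarrow> complex) \<Rightarrow> ('a \<Rightarrow> complex). inj_on e (coord_space n)"
proof -
  obtain f :: "(nat \<Rightarrow> complex) \<Rightarrow> complex" where f: "inj_on f (coord_space n)"
    using ex_inj_coord_space by blast
  have "inj_on (\<lambda>v (_ :: 'a). f v) (coord_space n)"
    using f by (auto simp: inj_on_def fun_eq_iff)
  then show ?thesis by blast
qed

text \<open>$\mathbb{C}^n$ with the inner product given by a positive definite Hermitian matrix \<open>a\<close>, transported
  to the type \<open>'v\<close> along an injection \<open>e\<close>. The constant \<open>\<delta>\<close> makes the norm equivalent to the Euclidean
  one, which gives completeness.\<close>

locale gram_space =
  fixes n :: nat and a :: "nat \<Rightarrow> nat \<Rightarrow> complex" and \<delta> :: real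
    and e :: "(nat \<Rightarrow> complex) \<Rightarrow> 'v"
  assumes hermitian: "\<And>i j. \<lbrakk>i < n; j < n\<rbrakk> \<Longrightarrow> a j i = cnj (a i j)"
    and \<delta>_pos: "\<delta> > 0"
    and coercive: "\<And>v. \<delta> * (\<Sum>i<n. (cmod (v i))\<^sup>2) \<le> Re (quad_form n a v)"
    and inj: "inj_on e (coord_space n)"
begin

definition coord :: "'v \<Rightarrow> nat \<Rightarrow> complex" where
  "coord = inv_into (coord_space n) e"

definition model :: "'v ip_space" where
  "model = \<lparr>carrier = e ` coord_space n, monoid.mult = undefined, one = undefined, zero = e (\<lambda>_. 0),
    add = (\<lambda>x y. e (\<lambda>i. coord x i + coord y i)), module.smult = (\<lambda>c x. e (\<lambda>i. c * coord x i)),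
    ip = (\<lambda>x y. \<Sum>i<n. \<Sum>j<n. a i j * coord x j * cnj (coord y i))\<rparr>"

lemma coord_e [simp]: "v \<in> coord_space n \<Longrightarrow> coord (e v) = v"
  unfolding coord_def by (rule inv_into_f_f[OF inj])

lemma coord_in [simp]: "x \<in> carrier model \<Longrightarrow> coord x \<in> coord_space n"
  and e_coord [simp]: "x \<in> carrier model \<Longrightarrow> e (coord x) = x"
  by (auto simp: model_def)

lemma e_in [simp]: "v \<in> coord_space n \<Longrightarrow> e v \<in> carrier model"
  by (simp add: model_def)

lemma coord_space_ops [simp]:
  "(\<lambda>_. 0) \<in> coord_space n"
  "\<lbrakk>v \<in> coord_space n; w \<in> coord_space n\<rbrakk> \<Longrightarrow> (\<lambda>i. v i + w i) \<in> coord_space n"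
  "\<lbrakk>v \<in> coord_space n; w \<in> coord_space n\<rbrakk> \<Longrightarrow> (\<lambda>i. v i - w i) \<in> coord_space n"
  "v \<in> coord_space n \<Longrightarrow> (\<lambda>i. c * v i) \<in> coord_space n"
  by (auto simp: coord_space_def)

lemma zero_model: "\<zero>\<^bsub>model\<^esub> = e (\<lambda>_. 0)"
  and add_model: "x \<oplus>\<^bsub>model\<^esub> y = e (\<lambda>i. coord x i + coord y i)"
  and smult_model: "c \<odot>\<^bsub>model\<^esub> x = e (\<lambda>i. c * coord x i)"
  and ip_model: "ip model x y = (\<Sum>i<n. \<Sum>j<n. a i j * coord x j * cnj (coord y i))"
  by (simp_all add: model_def)

lemma quad_form_eq_0:
  assumes "Re (quad_form n a v) = 0" "i < n"
  shows "v i = 0"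
proof -
  have "\<delta> * (\<Sum>i<n. (cmod (v i))\<^sup>2) \<le> 0"
    using coercive[of v] assms(1) by simp
  then have "(\<Sum>i<n. (cmod (v i))\<^sup>2) = 0"
    using \<delta>_pos by (simp add: mult_le_0_iff) (meson antisym sum_nonneg zero_le_power2)
  then show ?thesis
    using assms(2) by (simp add: sum_nonneg_eq_0_iff)
qed

lemma vectorspace_model: "vectorspace class_ring model"
proof (intro vectorspace.intro moduleI abelian_groupI)
  show "field (class_ring :: complex ring)"
    by (rule class_field.field_axioms)
  show "cring (class_ring :: complex ring)"
    by (rule class_cring.cring_axioms)
  fix x assume "x \<in> carrier model"
  then show "\<exists>y\<in>carrier model. y \<oplus>\<^bsub>model\<^esub> x = \<zero>\<^bsub>model\<^esub>"
    by (intro bexI[of _ "e (\<lambda>i. -1 * coord x i)"])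
      (auto simp: add_model zero_model coord_space_ops(4)[of _ "-1", simplified])
qed (auto simp: add_model zero_model smult_model algebra_simps)

lemma inner_product_model: "complex_inner_product_space model"
proof (intro complex_inner_product_space.intro complex_inner_product_space_axioms.intro vectorspace_model)
  fix x y z c assume x: "x \<in> carrier model" and y: "y \<in> carrier model"
  show "ip model (c \<odot>\<^bsub>model\<^esub> x) y = c * ip model x y"
    using x y by (simp add: ip_model smult_model sum_distrib_left mult_ac)
  show "ip model y x = cnj (ip model x y)"
  proof -
    have "cnj (ip model x y) = (\<Sum>i<n. \<Sum>j<n. a j i * coord y i * cnj (coord x j))"
      unfolding ip_model cnj_sum
    proof (intro sum.cong refl)
      fix i j assume "i \<in> {..<n}" "j \<in> {..<n}"
      then have "a j i = cnj (a i j)" by (intro hermitian) auto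
      then show "cnj (a i j * coord x j * cnj (coord y i)) = a j i * coord y i * cnj (coord x j)"
        by simp
    qed
    also have "\<dots> = ip model y x"
      unfolding ip_model by (rule sum.swap)
    finally show ?thesis by simp
  qed
next
  fix x y z assume "x \<in> carrier model" "y \<in> carrier model" "z \<in> carrier model"
  then show "ip model (x \<oplus>\<^bsub>model\<^esub> y) z = ip model x z + ip model y z"
    by (simp add: ip_model add_model algebra_simps sum.distrib)
next
  fix x assume x: "x \<in> carrier model"
  have q: "ip model x x = quad_form n a (coord x)"
    by (simp add: ip_model quad_form_def)
  have "0 \<le> Re (quad_form n a (coord x))"
    using coercive[of "coord x"] \<delta>_pos
    by (meson order_trans mult_nonneg_nonneg less_imp_le sum_nonneg zero_le_power2)
  moreover have "Im (quad_form n a (coord x)) = 0"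
    using quad_form_cnj[of n a "coord x", OF hermitian] by (simp add: complex_eq_iff)
  ultimately show "0 \<le> ip model x x"
    by (simp add: q less_eq_complex_def)
  assume "ip model x x = 0"
  then have "coord x i = 0" for i
    using quad_form_eq_0[of "coord x" i] coord_in[OF x] by (cases "i < n") (auto simp: q coord_space_def)
  then have "coord x = (\<lambda>_. 0)" by auto
  then show "x = \<zero>\<^bsub>model\<^esub>"
    using e_coord[OF x] by (simp add: zero_model)
qed

sublocale complex_inner_product_space model
  by (rule inner_product_model)

lemma hdist_model:
  assumes x: "x \<in> carrier model" and y: "y \<in> carrier model"
  shows "hdist model x y = sqrt (Re (quad_form n a (\<lambda>i. coord x i - coord y i)))"
proof -
  define z where "z = e (\<lambda>i. coord x i - coord y i)"
  have z: "z \<in> carrier model" using x y by (simp add: z_def)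
  have "z \<oplus>\<^bsub>model\<^esub> y = x"
    using x y by (simp add: add_model z_def)
  then have "x \<ominus>\<^bsub>model\<^esub> y = z"
    using x y z by (intro eq_if_ip_eq) (auto simp: ip_minus_left ip_plus_left)
  then show ?thesis
    using x y by (simp add: hdist_eq hnorm_def ip_model z_def quad_form_def)
qed

text \<open>By coercivity the coordinates of a Cauchy sequence are Cauchy, and convergence of the coordinates
  suffices for convergence, as the form is continuous in them.\<close>

lemma complex_hilbert_space_model: "complex_hilbert_space model"
proof (intro complex_hilbert_space.intro complex_hilbert_space_axioms.intro vectorspace_model)
  show "metric.mcomplete"
    unfolding metric.mcomplete_def
  proof (intro allI impI)
    fix \<sigma> assume \<sigma>: "metric.MCauchy \<sigma>"
    have \<sigma>C: "\<sigma> k \<in> carrier model" for k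
      using \<sigma> by (auto simp: metric.MCauchy_def)
    have "Cauchy (\<lambda>k. coord (\<sigma> k) i)" if i: "i < n" for i
      unfolding Cauchy_def
    proof (intro allI impI)
      fix \<epsilon> :: real assume "0 < \<epsilon>"
      then obtain N where N: "\<And>k l. \<lbrakk>N \<le> k; N \<le> l\<rbrakk> \<Longrightarrow> hdist model (\<sigma> k) (\<sigma> l) < sqrt \<delta> * \<epsilon>"
        using \<sigma> \<delta>_pos unfolding metric.MCauchy_def
        by (metis mult_pos_pos real_sqrt_gt_zero)
      have "dist (coord (\<sigma> k) i) (coord (\<sigma> l) i) < \<epsilon>" if "N \<le> k" "N \<le> l" for k l
      proof -
        let ?v = "\<lambda>i. coord (\<sigma> k) i - coord (\<sigma> l) i"
        have "(cmod (?v i))\<^sup>2 \<le> (\<Sum>i<n. (cmod (?v i))\<^sup>2)"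
          using i by (intro member_le_sum) auto
        then have "\<delta> * (cmod (?v i))\<^sup>2 \<le> Re (quad_form n a ?v)"
          using coercive[of ?v] \<delta>_pos by (meson mult_left_mono less_imp_le order_trans)
        then have "sqrt (\<delta> * (cmod (?v i))\<^sup>2) \<le> hdist model (\<sigma> k) (\<sigma> l)"
          by (simp only: hdist_model[OF \<sigma>C \<sigma>C] real_sqrt_le_iff)
        then have "sqrt \<delta> * cmod (?v i) < sqrt \<delta> * \<epsilon>"
          using N[OF that] by (simp add: real_sqrt_mult)
        then show ?thesis
          using \<delta>_pos by (simp add: dist_norm)
      qed
      then show "\<exists>M. \<forall>m\<ge>M. \<forall>n\<ge>M. dist (coord (\<sigma> m) i) (coord (\<sigma> n) i) < \<epsilon>"
        by blast
    qed
    then have "\<exists>L. (\<lambda>k. coord (\<sigma> k) i) \<longlonglongrightarrow> L" if "i < n" for i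
      using that by (simp add: Cauchy_convergent_iff convergent_def)
    then obtain L where L: "\<And>i. i < n \<Longrightarrow> (\<lambda>k. coord (\<sigma> k) i) \<longlonglongrightarrow> L i"
      by metis
    define l where "l = (\<lambda>i. if i < n then L i else 0)"
    have l: "l \<in> coord_space n"
      by (simp add: l_def coord_space_def)
    have "(\<lambda>k. \<Sum>i<n. \<Sum>j<n. a i j * (coord (\<sigma> k) j - l j) * cnj (coord (\<sigma> k) i - l i))
        \<longlonglongrightarrow> (\<Sum>i<n. \<Sum>j<n. a i j * (L j - l j) * cnj (L i - l i))"
      by (intro tendsto_intros L) auto
    then have "(\<lambda>k. quad_form n a (\<lambda>i. coord (\<sigma> k) i - l i)) \<longlonglongrightarrow> 0"
      by (simp add: quad_form_def l_def)
    then have "(\<lambda>k. sqrt (Re (quad_form n a (\<lambda>i. coord (\<sigma> k) i - l i)))) \<longlonglongrightarrow> sqrt (Re 0)"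
      by (intro tendsto_intros)
    then have "(\<lambda>k. hdist model (\<sigma> k) (e l)) \<longlonglongrightarrow> 0"
      using l by (simp add: hdist_model[OF \<sigma>C])
    then show "\<exists>x. limitin metric.mtopology \<sigma> x sequentially"
      using l \<sigma>C by (auto simp: metric.limitin_metric_dist_null intro!: exI[of _ "e l"])
  qed
qed (rule ip_plus_left ip_scale_left ip_sym ip_ge_0 ip_eq_0D; assumption)+

definition basis_vec :: "nat \<Rightarrow> 'v" where
  "basis_vec i = e (\<lambda>k. if k = i then 1 else 0)"

lemma basis_vec_in [simp]: "i < n \<Longrightarrow> basis_vec i \<in> carrier model"
  by (auto simp: basis_vec_def coord_space_def)

lemma coord_basis_vec: "i < n \<Longrightarrow> coord (basis_vec i) = (\<lambda>k. if k = i then 1 else 0)"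
  unfolding basis_vec_def by (rule coord_e) (auto simp: coord_space_def)

lemma ip_basis_vec:
  assumes "i < n" "j < n"
  shows "ip model (basis_vec i) (basis_vec j) = a j i"
proof -
  have "(\<Sum>l<n. a k l * coord (basis_vec i) l * cnj (coord (basis_vec j) k)) = (if k = j then a k i else 0)" for k
  proof -
    have "(\<Sum>l<n. a k l * coord (basis_vec i) l * cnj (coord (basis_vec j) k))
        = (\<Sum>l<n. if l = i then (if k = j then a k i else 0) else 0)"
      using assms by (intro sum.cong) (auto simp: coord_basis_vec)
    then show ?thesis using assms by simp
  qed
  then show ?thesis
    using assms by (simp add: ip_model)
qed

end

section \<open>The lower bound\<close>

text \<open>The additional assumptions say that \<open>a\<close> is admissible, so that the lines spanned by the basis
  vectors have Friedrichs number at most \<open>c\<close>.\<close>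

locale unit_gram_space = gram_space n a \<delta> e
  for n a \<delta> and e :: "(nat \<Rightarrow> complex) \<Rightarrow> 'v" +
  fixes c :: real
  assumes n2: "n \<ge> 2" and c0: "0 \<le> c"
    and unit_diag: "\<And>i. i < n \<Longrightarrow> a i i = 1"
    and upper: "\<And>v. Re (quad_form n a v) \<le> (1 + (real n - 1) * c) * (\<Sum>i<n. (cmod (v i))\<^sup>2)"
begin

definition line :: "nat \<Rightarrow> 'v set" where
  "line i = range (\<lambda>t. t \<odot>\<^bsub>model\<^esub> basis_vec (i - 1))"

lemma hnorm_basis_vec: "i < n \<Longrightarrow> hnorm model (basis_vec i) = 1"
  by (simp add: hnorm_def ip_basis_vec unit_diag)

lemma closed_line: "i \<in> {1..n} \<Longrightarrow> closed_subspace model (line i)"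
  unfolding line_def by (intro closed_subspace_line) auto

text \<open>Already two of the lines meet in 0 only; here \<open>n \<ge> 2\<close> enters.\<close>

lemma common_line: "common_subspace n line = {\<zero>\<^bsub>model\<^esub>}"
proof
  show "common_subspace n line \<subseteq> {\<zero>\<^bsub>model\<^esub>}"
  proof
    fix x assume "x \<in> common_subspace n line"
    then have "x \<in> line 1" and "x \<in> line 2"
      using n2 by (auto simp: common_subspace_def)
    from \<open>x \<in> line 1\<close> obtain s where s: "x = s \<odot>\<^bsub>model\<^esub> basis_vec 0"
      by (auto simp: line_def)
    from \<open>x \<in> line 2\<close> obtain t where t: "x = t \<odot>\<^bsub>model\<^esub> basis_vec 1"
      by (auto simp: line_def)
    have "coord (s \<odot>\<^bsub>model\<^esub> basis_vec 0) 0 = coord (t \<odot>\<^bsub>model\<^esub> basis_vec 1) 0"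
      using s t by simp
    then have "s = 0"
      using n2 coord_in[OF basis_vec_in, of 0] coord_in[OF basis_vec_in, of 1]
      by (simp add: smult_model coord_space_ops(4)) (simp add: coord_basis_vec)
    then show "x \<in> {\<zero>\<^bsub>model\<^esub>}"
      by (simp add: s smult_model zero_model)
  qed
  show "{\<zero>\<^bsub>model\<^esub>} \<subseteq> common_subspace n line"
    using closed_subspace_zero[OF closed_line] by (auto simp: common_subspace_def)
qed

lemma friedrichs_line: "friedrichs_number model n line \<le> c"
proof (rule friedrichs_number_le_iff[THEN iffD2, rule_format, OF n2 c0])
  show "line i \<subseteq> carrier model" if "i \<in> {1..n}" for i
    using closed_subspace_subset[OF closed_line[OF that]] .
  fix x assume x: "\<And>i. i \<in> {1..n} \<Longrightarrow> x i \<in> orth_diff model (line i) (common_subspace n line)"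
  have "\<exists>t. x i = t \<odot>\<^bsub>model\<^esub> basis_vec (i - 1)" if "i \<in> {1..n}" for i
    using x[OF that] by (auto simp: orth_diff_def line_def)
  then obtain t where t: "\<And>i. i \<in> {1..n} \<Longrightarrow> x i = t i \<odot>\<^bsub>model\<^esub> basis_vec (i - 1)"
    by metis
  have "(\<Sum>i\<in>{1..n}. \<Sum>j\<in>{1..n}. Re (ip model (x i) (x j)))
      = (\<Sum>i<n. \<Sum>j<n. Re (a j i * t (Suc i) * cnj (t (Suc j))))"
    unfolding One_nat_def sum.atLeast1_atMost_eq
    by (intro sum.cong refl) (simp add: t ip_scale_left ip_scale_right ip_basis_vec mult_ac)
  also have "\<dots> = (\<Sum>j<n. \<Sum>i<n. Re (a j i * t (Suc i) * cnj (t (Suc j))))"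
    by (rule sum.swap)
  also have "\<dots> = Re (quad_form n a (\<lambda>i. t (Suc i)))"
    by (simp add: quad_form_def)
  also have "\<dots> \<le> (1 + (real n - 1) * c) * (\<Sum>i<n. (cmod (t (Suc i)))\<^sup>2)"
    by (rule upper)
  also have "(\<Sum>i<n. (cmod (t (Suc i)))\<^sup>2) = (\<Sum>i\<in>{1..n}. (hnorm model (x i))\<^sup>2)"
    unfolding One_nat_def sum.atLeast1_atMost_eq
    by (intro sum.cong refl) (simp add: t hnorm_smult hnorm_basis_vec)
  finally show "(\<Sum>i\<in>{1..n}. \<Sum>j\<in>{1..n}. Re (ip model (x i) (x j)))
      \<le> (1 + (real n - 1) * c) * (\<Sum>i\<in>{1..n}. (hnorm model (x i))\<^sup>2)" .
qed

text \<open>Projecting a multiple of one basis vector to the line of the next multiplies the coefficient by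
  their inner product, a superdiagonal entry up to conjugation.\<close>

lemma proj_product_line:
  assumes "k < n"
  shows "\<exists>s. proj_product model line (Suc k) (basis_vec 0) = s \<odot>\<^bsub>model\<^esub> basis_vec k \<and> cmod s = cmod (\<Prod>i<k. a i (Suc i))"
  using assms
proof (induction k)
  case 0
  then have "orth_proj model (line 1) (basis_vec 0) = ip model (basis_vec 0) (basis_vec 0) \<odot>\<^bsub>model\<^esub> basis_vec 0"
    unfolding line_def using orth_proj_line[of "basis_vec 0" "basis_vec 0"] hnorm_basis_vec[of 0] by simp
  with 0 show ?case by (intro exI[of _ 1]) (simp add: ip_basis_vec unit_diag)
next
  case (Suc k)
  then obtain s where s: "proj_product model line (Suc k) (basis_vec 0) = s \<odot>\<^bsub>model\<^esub> basis_vec k"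
    "cmod s = cmod (\<Prod>i<k. a i (Suc i))"
    by auto
  have "proj_product model line (Suc (Suc k)) (basis_vec 0) = orth_proj model (line (Suc (Suc k))) (s \<odot>\<^bsub>model\<^esub> basis_vec k)"
    using s(1) by simp
  also have "\<dots> = ip model (s \<odot>\<^bsub>model\<^esub> basis_vec k) (basis_vec (Suc k)) \<odot>\<^bsub>model\<^esub> basis_vec (Suc k)"
    unfolding line_def using orth_proj_line[of "basis_vec (Suc k)" "s \<odot>\<^bsub>model\<^esub> basis_vec k"] hnorm_basis_vec[of "Suc k"] Suc.prems
    by simp
  finally have eq: "proj_product model line (Suc (Suc k)) (basis_vec 0)
      = ip model (s \<odot>\<^bsub>model\<^esub> basis_vec k) (basis_vec (Suc k)) \<odot>\<^bsub>model\<^esub> basis_vec (Suc k)" .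
  have "ip model (s \<odot>\<^bsub>model\<^esub> basis_vec k) (basis_vec (Suc k)) = s * cnj (a k (Suc k))"
    using Suc.prems hermitian[of k "Suc k"] by (simp add: ip_scale_left ip_basis_vec)
  then have "cmod (ip model (s \<odot>\<^bsub>model\<^esub> basis_vec k) (basis_vec (Suc k))) = cmod (\<Prod>i<Suc k. a i (Suc i))"
    using s(2) by (simp add: norm_mult)
  with eq show ?case by blast
qed

lemma hnorm_proj_product_line:
  "hnorm model (proj_product model line n (basis_vec 0) \<ominus>\<^bsub>model\<^esub> orth_proj model (common_subspace n line) (basis_vec 0))
    = cmod (\<Prod>i<n - 1. a i (Suc i))"
proof -
  have 0: "0 < n" using n2 by simp
  have cl: "closed_subspace model {\<zero>\<^bsub>model\<^esub>}"
    using closed_subspace_common[of n line] closed_line n2 by (simp add: common_line)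
  have "orth_proj model {\<zero>\<^bsub>model\<^esub>} (basis_vec 0) = \<zero>\<^bsub>model\<^esub>"
    by (rule orth_proj_eqI[OF cl]) (use 0 in auto)
  moreover obtain s where "proj_product model line (Suc (n - 1)) (basis_vec 0) = s \<odot>\<^bsub>model\<^esub> basis_vec (n - 1)"
    "cmod s = cmod (\<Prod>i<n - 1. a i (Suc i))"
    using proj_product_line[of "n - 1"] 0 by auto
  moreover have "x \<ominus>\<^bsub>model\<^esub> \<zero>\<^bsub>model\<^esub> = x" if "x \<in> carrier model" for x
    using that by (intro eq_if_ip_eq) (auto simp: ip_minus_left)
  ultimately show ?thesis
    using 0 by (simp add: common_line hnorm_smult hnorm_basis_vec)
qed

end

text \<open>The system consists of the coordinate lines for the inner product $tA+(1-t)I$, and the witness is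
  the first basis vector.\<close>

theorem scaled_admissible_realized:
  assumes n: "n \<ge> 2" and c: "0 \<le> c" and a: "admissible n c a" and t: "0 < t" "t < 1"
  shows "\<exists>(H :: ('a \<Rightarrow> complex) ip_space) S x. complex_hilbert_space H \<and>
    (\<forall>i\<in>{1..n}. closed_subspace H (S i)) \<and> friedrichs_number H n S \<le> c \<and>
    x \<in> carrier H \<and> hnorm H x \<le> 1 \<and>
    hnorm H (proj_product H S n x \<ominus>\<^bsub>H\<^esub> orth_proj H (common_subspace n S) x)
      = t ^ (n - 1) * cmod (\<Prod>i<n - 1. a i (Suc i))"
proof -
  \<comment> \<open>the convex combination of \<open>a\<close> and the identity with weights \<open>t\<close> and \<open>1 - t\<close>\<close>
  define a' where "a' i j = complex_of_real t * a i j - (if i = j then complex_of_real (t - 1) else 0)"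
    for i j
  have q: "Re (quad_form n a' v) = t * Re (quad_form n a v) + (1 - t) * (\<Sum>i<n. (cmod (v i))\<^sup>2)" for v
  proof -
    have "quad_form n (\<lambda>i j. complex_of_real t * a i j) v = complex_of_real t * quad_form n a v"
      by (simp add: quad_form_def sum_distrib_left mult_ac)
    then have "quad_form n a' v = complex_of_real t * quad_form n a v
        - complex_of_real (t - 1) * complex_of_real (\<Sum>i<n. (cmod (v i))\<^sup>2)"
      unfolding a'_def quad_form_diff quad_form_scaled_identity by simp
    from arg_cong[OF this, of Re] show ?thesis
      by (simp add: algebra_simps del: of_real_sum)
  qed
  have herm: "a j i = cnj (a i j)" if "i < n" "j < n" for i j
    using a that unfolding admissible_def by blast
  have diag: "a i i = 1" if "i < n" for i
    using a that unfolding admissible_def by blast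
  have nonneg: "0 \<le> Re (quad_form n a v)" for v
    using a unfolding admissible_def by blast
  have le: "Re (quad_form n a v) \<le> (1 + (real n - 1) * c) * (\<Sum>i<n. (cmod (v i))\<^sup>2)" for v
    using a unfolding admissible_def by blast
  obtain e :: "(nat \<Rightarrow> complex) \<Rightarrow> ('a \<Rightarrow> complex)" where e: "inj_on e (coord_space n)"
    using ex_coord_embedding by blast
  interpret unit_gram_space n a' "1 - t" e c
  proof
    show "a' j i = cnj (a' i j)" if "i < n" "j < n" for i j
      using herm[OF that] by (simp add: a'_def)
    show "(1 - t) * (\<Sum>i<n. (cmod (v i))\<^sup>2) \<le> Re (quad_form n a' v)" for v
      using nonneg[of v] t by (simp add: q)
    show "Re (quad_form n a' v) \<le> (1 + (real n - 1) * c) * (\<Sum>i<n. (cmod (v i))\<^sup>2)" for v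
    proof -
      let ?N = "\<Sum>i<n. (cmod (v i))\<^sup>2"
      have "0 \<le> ((real n - 1) * c) * ?N"
        using n c by (intro mult_nonneg_nonneg sum_nonneg) auto
      then have "?N \<le> (1 + (real n - 1) * c) * ?N"
        by (simp add: distrib_right)
      then have "t * Re (quad_form n a v) + (1 - t) * ?N
          \<le> t * ((1 + (real n - 1) * c) * ?N) + (1 - t) * ((1 + (real n - 1) * c) * ?N)"
        using t le[of v] by (intro add_mono mult_left_mono) auto
      then show ?thesis
        unfolding q by (simp add: algebra_simps)
    qed
  qed (use t e n c diag in \<open>auto simp: a'_def\<close>)
  have "cmod (\<Prod>i<n - 1. a' i (Suc i)) = t ^ (n - 1) * cmod (\<Prod>i<n - 1. a i (Suc i))"
    using t by (simp add: a'_def prod.distrib norm_mult norm_power)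
  then show ?thesis
    using complex_hilbert_space_model closed_line friedrichs_line basis_vec_in[of 0] hnorm_basis_vec[of 0] n
      hnorm_proj_product_line
    by (intro exI[of _ model] exI[of _ line] exI[of _ "basis_vec 0"]) auto
qed

section \<open>The maximum\<close>

theorem theorem2p1:
  fixes n :: nat
    and c :: real
  assumes "n \<ge> 2" and "0 \<le> c" and "c \<le> 1"
  shows "(\<exists>A\<in>admissible_mats n c. f_sup TYPE('a \<Rightarrow> complex) n c = cmod (superdiag_prod n A)) \<and>
         (\<forall>A\<in>admissible_mats n c. cmod (superdiag_prod n A) \<le> f_sup TYPE('a \<Rightarrow> complex) n c)"
proof -
  let ?T = "\<lambda>(H :: ('a \<Rightarrow> complex) ip_space) S x.
    proj_product H S n x \<ominus>\<^bsub>H\<^esub> orth_proj H (common_subspace n S) x"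
  let ?N = "{op_norm H (?T H S) | (H :: ('a \<Rightarrow> complex) ip_space) S.
    complex_hilbert_space H \<and> (\<forall>i\<in>{1..n}. closed_subspace H (S i)) \<and> friedrichs_number H n S \<le> c}"
  let ?p = "\<lambda>a :: nat \<Rightarrow> nat \<Rightarrow> complex. cmod (\<Prod>i<n - 1. a i (Suc i))"
  have f: "f_sup TYPE('a \<Rightarrow> complex) n c = Sup ?N"
    by (simp add: f_sup_def)
  have n1: "1 \<le> n" using assms(1) by simp
  obtain m where m: "admissible n c m" and max: "\<And>a. admissible n c a \<Longrightarrow> ?p a \<le> ?p m"
    using admissible_attains_max[OF n1 assms(2)] by blast
  have pointwise: "hnorm H (?T H S x) \<le> ?p m"
    if H: "complex_hilbert_space H" and S: "\<forall>i\<in>{1..n}. closed_subspace H (S i)"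
      and F: "friedrichs_number H n S \<le> c" and x: "x \<in> carrier H" "hnorm H x \<le> 1" for H :: "('a \<Rightarrow> complex) ip_space" and S x
  proof -
    interpret complex_hilbert_space H by (rule H)
    obtain a where "admissible n c a" "hnorm H (?T H S x) \<le> ?p a"
      using proj_product_bound[OF assms(1,2) _ F x] S by blast
    then show ?thesis using max[of a] by linarith
  qed
  have op_le: "op_norm H (?T H S) \<le> ?p m"
    if "complex_hilbert_space H" "\<forall>i\<in>{1..n}. closed_subspace H (S i)" "friedrichs_number H n S \<le> c"
    for H :: "('a \<Rightarrow> complex) ip_space" and S
  proof -
    interpret complex_hilbert_space H by fact
    have "\<zero>\<^bsub>H\<^esub> \<in> carrier H" "hnorm H \<zero>\<^bsub>H\<^esub> \<le> 1" by auto
    then show ?thesis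
      unfolding op_norm_def using pointwise[OF that] by (intro cSup_least) blast+
  qed
  have bdd: "bdd_above ?N"
    using op_le by (intro bdd_aboveI[of _ "?p m"]) blast
  have lower_scaled: "?N \<noteq> {} \<and> t ^ (n - 1) * ?p a \<le> Sup ?N"
    if a: "admissible n c a" and t: "0 < t" "t < 1" for a t
  proof -
    obtain H :: "('a \<Rightarrow> complex) ip_space" and S x where H: "complex_hilbert_space H"
      and S: "\<forall>i\<in>{1..n}. closed_subspace H (S i)" and F: "friedrichs_number H n S \<le> c"
      and x: "x \<in> carrier H" "hnorm H x \<le> 1" and eq: "hnorm H (?T H S x) = t ^ (n - 1) * ?p a"
      using scaled_admissible_realized[OF assms(1,2) a t] by blast
    have "hnorm H (?T H S x) \<le> op_norm H (?T H S)"
      unfolding op_norm_def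
    proof (rule cSup_upper)
      show "hnorm H (?T H S x) \<in> {hnorm H (?T H S x) |x. x \<in> carrier H \<and> hnorm H x \<le> 1}"
        using x by blast
      show "bdd_above {hnorm H (?T H S x) |x. x \<in> carrier H \<and> hnorm H x \<le> 1}"
        using pointwise[OF H S F] by (intro bdd_aboveI[of _ "?p m"]) blast
    qed
    moreover have "op_norm H (?T H S) \<in> ?N"
      using H S F by blast
    ultimately show ?thesis
      using cSup_upper[OF _ bdd] eq by fastforce
  qed
  have lower: "?p a \<le> Sup ?N" if a: "admissible n c a" for a
  proof -
    have "((\<lambda>t. t ^ (n - 1) * ?p a) \<longlongrightarrow> 1 ^ (n - 1) * ?p a) (at_left (1 :: real))"
      by (intro tendsto_intros)
    moreover have "eventually (\<lambda>t. t \<in> {0<..<1}) (at_left (1 :: real))"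
      by (rule eventually_at_left_real) simp
    then have "eventually (\<lambda>t :: real. t ^ (n - 1) * ?p a \<le> Sup ?N) (at_left 1)"
    proof (rule eventually_mono)
      fix t :: real assume "t \<in> {0<..<1}"
      then show "t ^ (n - 1) * ?p a \<le> Sup ?N"
        using lower_scaled[OF a, of t] by simp
    qed
    ultimately have "1 ^ (n - 1) * ?p a \<le> Sup ?N"
      by (rule tendsto_upperbound) simp
    then show ?thesis by simp
  qed
  \<comment> \<open>needed because the supremum of the empty set of reals is unspecified\<close>
  have "?N \<noteq> {}"
    using lower_scaled[OF m, of "1/2"] by simp
  then have "Sup ?N \<le> ?p m"
    using op_le by (intro cSup_least) blast+
  with lower[OF m] have eq: "Sup ?N = ?p m" by (rule antisym[rotated])
  let ?M = "mat n n (\<lambda>(i, j). m i j)"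
  have "superdiag_prod n ?M = (\<Prod>i<n - 1. m i (Suc i))"
    unfolding superdiag_prod_def by (intro prod.cong) auto
  then have "f_sup TYPE('a \<Rightarrow> complex) n c = cmod (superdiag_prod n ?M)"
    unfolding f eq by simp
  moreover have "cmod (superdiag_prod n A) \<le> f_sup TYPE('a \<Rightarrow> complex) n c" if "A \<in> admissible_mats n c" for A
    using lower[of "\<lambda>i j. A $$ (i, j)"] that
    unfolding f by (simp add: admissible_mats_iff superdiag_prod_def)
  ultimately show ?thesis
    using admissible_mat[OF m] by blast
qed

end
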